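(* Let $X$ and $Y$ be Banach spaces such that one of the following conditions holds: (i) either $X$ or $Y$ has the Dunford-Pettis property; (ii) $\mathcal{L}(X,Y^* )=\mathcal{K}(X,Y^* )$. Then: (a) If $(x_n)_{n\in\mathbb{N}}$ and $(y_n)_{n\in\mathbb{N}}$ are weakly Cauchy sequences in $X$ and $Y$, respectively, then $(x_n\otimes y_n)_{n\in\mathbb{N}}$ is weakly Cauchy in $X\widehat{\otimes}_\pi Y$. (b) If $W_1\subseteq X$ and $W_2\subseteq Y$ are weakly precompact sets, then $W_1\otimes W_2$ is weakly precompact in $X\widehat{\otimes}_\pi Y$. (c) If $X$ and $Y$ contain no subspace isomorphic to $\ell_1$, then $X\widehat{\otimes}_\pi Y$ contains no subspace isomorphic to $\ell_1$.
   Context: All Banach spaces are real; subspaces are norm closed linear subspaces. $X\widehat{\otimes}_\pi Y$ denotes the projective tensor product of $X$ and $Y$. $\mathcal{L}(X,Y^* )$ is the space of all continuous linear maps from $X$ to the dual $Y^*$, and $\mathcal{K}(X,Y^* )$ is its subspace of compact operators. For $W_1\subseteq X$ and $W_2\subseteq Y$, put $W_1\otimes W_2:=\{x\otimes y:\ x\in W_1,\ y\in W_2\}$. A subset of a Banach space is weakly precompact if every sequence in it admits a weakly Cauchy subsequence. A Banach space $Z$ has the Dunford-Pettis property if $z_n^*(z_n)\to 0$ whenever $(z_n)$ is weakly null in $Z$ and $(z_n^* )$ is weakly null in $Z^*$. *)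

theory Defs
  imports "HOL-Analysis.Analysis"
begin

section \<open>Bounded functionals separate points\<close>

definition sublinear :: "('a::real_vector \<Rightarrow> real) \<Rightarrow> bool" where
  "sublinear p \<longleftrightarrow> (\<forall>x y. p (x + y) \<le> p x + p y) \<and> (\<forall>r x. r > 0 \<longrightarrow> p (r *\<^sub>R x) \<le> r * p x)"

lemma sublinear_add: "sublinear p \<Longrightarrow> p (x + y) \<le> p x + p y"
  by (simp add: sublinear_def)

lemma sublinear_le: "sublinear p \<Longrightarrow> r > 0 \<Longrightarrow> p (r *\<^sub>R x) \<le> r * p x"
  by (simp add: sublinear_def)

lemma sublinear_zero: assumes "sublinear p" shows "p 0 = 0"
  using sublinear_add[OF assms, of 0 0] sublinear_le[OF assms, of "1/2" 0] by simp

lemma sublinear_scale: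
  assumes "sublinear p" "r \<ge> 0" shows "p (r *\<^sub>R x) = r * p x"
proof (cases "r = 0")
  case True then show ?thesis by (simp add: sublinear_zero[OF assms(1)])
next
  case False
  then have r: "r > 0" using assms by simp
  have "p (inverse r *\<^sub>R (r *\<^sub>R x)) \<le> inverse r * p (r *\<^sub>R x)"
    using r by (intro sublinear_le assms) auto
  then have "r * p x \<le> p (r *\<^sub>R x)" using r by (simp add: field_simps)
  with sublinear_le[OF assms(1) r, of x] show ?thesis by simp
qed

lemma sublinear_neg: assumes "sublinear p" shows "- p (- x) \<le> p x"
  using sublinear_add[OF assms, of x "- x"] sublinear_zero[OF assms] by simp

lemma sublinear_reduce:
  fixes p :: "'a::real_vector \<Rightarrow> real"
  assumes p: "sublinear p"
  obtains q where "sublinear q" "\<And>y. q y \<le> p y" "q (- x) \<le> - p x"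
proof -
  define q where "q y = (INF t\<in>{0..}. p (y + t *\<^sub>R x) - t * p x)" for y
  have low: "- p (- y) \<le> p (y + t *\<^sub>R x) - t * p x" if "t \<ge> 0" for t y
    using sublinear_add[OF p, of "- y" "y + t *\<^sub>R x"] sublinear_scale[OF p that, of x]
    by (simp add: algebra_simps)
  then have bdd: "bdd_below ((\<lambda>t. p (y + t *\<^sub>R x) - t * p x) ` {0..})" for y
    by (intro bdd_belowI2) auto
  have le: "q y \<le> p (y + t *\<^sub>R x) - t * p x" if "t \<ge> 0" for t y
    unfolding q_def using that by (intro cINF_lower bdd) auto
  have ge: "c \<le> q y" if "\<And>t. t \<ge> 0 \<Longrightarrow> c \<le> p (y + t *\<^sub>R x) - t * p x" for c y
    unfolding q_def using that by (intro cINF_greatest) auto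
  have "q (y + z) \<le> q y + q z" for y z
  proof -
    have "q (y + z) - q z \<le> q y"
    proof (rule ge)
      fix s :: real assume s: "s \<ge> 0"
      have "q (y + z) - (p (y + s *\<^sub>R x) - s * p x) \<le> q z"
      proof (rule ge)
        fix t :: real assume t: "t \<ge> 0"
        have "q (y + z) \<le> p ((y + z) + (s + t) *\<^sub>R x) - (s + t) * p x"
          using s t by (intro le) auto
        also have "(y + z) + (s + t) *\<^sub>R x = (y + s *\<^sub>R x) + (z + t *\<^sub>R x)"
          by (simp add: algebra_simps)
        also have "p \<dots> \<le> p (y + s *\<^sub>R x) + p (z + t *\<^sub>R x)"
          by (rule sublinear_add[OF p])
        finally show "q (y + z) - (p (y + s *\<^sub>R x) - s * p x) \<le> p (z + t *\<^sub>R x) - t * p x"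
          by (simp add: algebra_simps)
      qed
      then show "q (y + z) - q z \<le> p (y + s *\<^sub>R x) - s * p x" by simp
    qed
    then show ?thesis by simp
  qed
  moreover have "q (r *\<^sub>R y) \<le> r * q y" if r: "r > 0" for r y
  proof -
    have "q (r *\<^sub>R y) / r \<le> q y"
    proof (rule ge)
      fix t :: real assume t: "t \<ge> 0"
      have "q (r *\<^sub>R y) \<le> p (r *\<^sub>R y + (r * t) *\<^sub>R x) - (r * t) * p x"
        using r t by (intro le) auto
      also have "r *\<^sub>R y + (r * t) *\<^sub>R x = r *\<^sub>R (y + t *\<^sub>R x)"
        by (simp add: algebra_simps)
      also have "p \<dots> = r * p (y + t *\<^sub>R x)"
        using r by (intro sublinear_scale[OF p]) auto
      finally show "q (r *\<^sub>R y) / r \<le> p (y + t *\<^sub>R x) - t * p x"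
        using r by (simp add: field_simps)
    qed
    then show ?thesis using r by (simp add: field_simps)
  qed
  ultimately have "sublinear q" by (simp add: sublinear_def)
  moreover have "q y \<le> p y" for y using le[of 0 y] by simp
  moreover have "q (- x) \<le> - p x"
    using le[of 1 "- x"] sublinear_zero[OF p] by simp
  ultimately show ?thesis by (rule that)
qed

lemma sublinear_dominates_linear:
  fixes p :: "'a::real_vector \<Rightarrow> real"
  assumes p: "sublinear p"
  obtains f where "linear f" "\<And>y. f y \<le> p y"
proof -
  define A where "A = {q. sublinear q \<and> q \<le> p}"
  let ?P = "\<lambda>a b :: 'a \<Rightarrow> real. b \<le> a"
  have "\<exists>m\<in>A. \<forall>a\<in>A. ?P m a \<longrightarrow> a = m"
  proof (rule predicate_Zorn)
    show "partial_order_on A (relation_of ?P A)"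
      by (rule partial_order_on_relation_ofI) auto
    fix C assume C: "C \<in> Chains (relation_of ?P A)"
    then have CA: "q \<in> A" if "q \<in> C" for q
      using that by (auto simp: Chains_def relation_of_def)
    have ch: "q \<le> q' \<or> q' \<le> q" if "q \<in> C" "q' \<in> C" for q q'
      using C that by (auto simp: Chains_def relation_of_def)
    show "\<exists>u\<in>A. \<forall>a\<in>C. ?P a u"
    proof (cases "C = {}")
      case True
      have "p \<in> A" using p by (simp add: A_def)
      with True show ?thesis by blast
    next
      case False
      define u where "u y = (INF q\<in>C. q y)" for y
      have "- p (- y) \<le> q y" if "q \<in> C" for q y
      proof -
        have "- q (- y) \<le> q y" and "q (- y) \<le> p (- y)"
          using CA[OF that] sublinear_neg by (auto simp: A_def le_fun_def)
        then show ?thesis by linarith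
      qed
      then have bdd: "bdd_below ((\<lambda>q. q y) ` C)" for y
        by (intro bdd_belowI2) auto
      have le: "u y \<le> q y" if "q \<in> C" for q y
        unfolding u_def using that by (intro cINF_lower bdd) auto
      have ge: "c \<le> u y" if "\<And>q. q \<in> C \<Longrightarrow> c \<le> q y" for c y
        unfolding u_def using that False by (intro cINF_greatest) auto
      have sub: "sublinear q" if "q \<in> C" for q using CA[OF that] by (simp add: A_def)
      have "u (y + z) \<le> u y + u z" for y z
      proof -
        have "u (y + z) - u z \<le> u y"
        proof (rule ge)
          fix q assume q: "q \<in> C"
          have "u (y + z) - q y \<le> u z"
          proof (rule ge)
            fix q' assume q': "q' \<in> C"
            obtain q'' where q'': "q'' \<in> C" "q'' \<le> q" "q'' \<le> q'"
              using ch[OF q q'] q q' by blast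
            have "u (y + z) \<le> q'' (y + z)" by (rule le[OF q''(1)])
            also have "\<dots> \<le> q'' y + q'' z" by (rule sublinear_add[OF sub[OF q''(1)]])
            also have "\<dots> \<le> q y + q' z" using q'' by (intro add_mono) (auto simp: le_fun_def)
            finally show "u (y + z) - q y \<le> q' z" by simp
          qed
          then show "u (y + z) - u z \<le> q y" by simp
        qed
        then show ?thesis by simp
      qed
      moreover have "u (r *\<^sub>R y) \<le> r * u y" if r: "r > 0" for r y
      proof -
        have "u (r *\<^sub>R y) / r \<le> u y"
        proof (rule ge)
          fix q assume q: "q \<in> C"
          have "u (r *\<^sub>R y) \<le> q (r *\<^sub>R y)" by (rule le[OF q])
          also have "\<dots> \<le> r * q y" by (rule sublinear_le[OF sub[OF q] r])
          finally show "u (r *\<^sub>R y) / r \<le> q y" using r by (simp add: field_simps)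
        qed
        then show ?thesis using r by (simp add: field_simps)
      qed
      ultimately have "sublinear u" by (simp add: sublinear_def)
      moreover obtain q where q: "q \<in> C" using False by blast
      have "u y \<le> p y" for y
        using le[OF q, of y] CA[OF q] by (auto simp: A_def le_fun_def intro: order_trans)
      ultimately have "u \<in> A" by (simp add: A_def le_fun_def)
      then show ?thesis using le by (auto simp: le_fun_def)
    qed
  qed
  then obtain m where m: "sublinear m" "m \<le> p"
    and min: "\<And>a. sublinear a \<Longrightarrow> a \<le> m \<Longrightarrow> a = m"
    unfolding A_def by (smt (verit) mem_Collect_eq order_trans)
  have neg: "m (- x) = - m x" for x
  proof -
    obtain q where q: "sublinear q" "\<And>y. q y \<le> m y" "q (- x) \<le> - m x"
      using sublinear_reduce[OF m(1), of x] by blast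
    have "q = m" using q by (intro min) (auto simp: le_fun_def)
    then show ?thesis using q(3) sublinear_neg[OF m(1), of x] by simp
  qed
  have "linear m"
  proof (rule linearI)
    fix x y
    have "m (- x + - y) \<le> m (- x) + m (- y)" by (rule sublinear_add[OF m(1)])
    moreover have "m (- x + - y) = - m (x + y)" using neg[of "x + y"] by simp
    ultimately show "m (x + y) = m x + m y"
      using sublinear_add[OF m(1), of x y] by (simp add: neg)
  next
    fix r x
    show "m (r *\<^sub>R x) = r *\<^sub>R m x"
    proof (cases "r \<ge> 0")
      case True then show ?thesis by (simp add: sublinear_scale[OF m(1)])
    next
      case False
      then show ?thesis using sublinear_scale[OF m(1), of "- r" x] neg[of "r *\<^sub>R x"] by simp
    qed
  qed
  then show ?thesis using m(2) by (intro that) (auto simp: le_fun_def)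
qed

lemma bounded_linear_separating:
  fixes x :: "'a::real_normed_vector"
  assumes "x \<noteq> 0"
  obtains f :: "'a \<Rightarrow> real" where "bounded_linear f" "f x \<noteq> 0"
proof -
  have "sublinear (norm :: 'a \<Rightarrow> real)"
    by (auto simp: sublinear_def norm_triangle_ineq)
  then obtain q where q: "sublinear q" "\<And>y. q y \<le> norm y" "q (- x) \<le> - norm x"
    by (rule sublinear_reduce[of norm x]) blast
  obtain f where f: "linear f" "\<And>y. f y \<le> q y"
    using sublinear_dominates_linear[OF q(1)] by blast
  have fle: "f y \<le> norm y" for y using f(2)[of y] q(2)[of y] by linarith
  have "\<bar>f y\<bar> \<le> norm y" for y
    using fle[of y] fle[of "- y"] linear_neg[OF f(1), of y] by auto
  then have "bounded_linear f"
    using f(1) by (auto simp: bounded_linear_def bounded_linear_axioms_def intro!: exI[of _ 1])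
  moreover have "f x \<noteq> 0"
    using f(2)[of "- x"] q(3) linear_neg[OF f(1), of x] zero_less_norm_iff[of x] assms by linarith
  ultimately show ?thesis by (rule that)
qed

lemma biorthogonal_functionals:
  fixes B :: "'a::real_normed_vector set"
  assumes "finite B" "independent B"
  shows "\<exists>\<phi>. (\<forall>b\<in>B. bounded_linear (\<phi> b :: 'a \<Rightarrow> real)) \<and>
              (\<forall>b\<in>B. \<forall>c\<in>B. \<phi> b c = (if b = c then 1 else 0))"
  using assms
proof (induction B rule: finite_induct)
  case empty then show ?case by auto
next
  case (insert e B)
  have ind: "independent B" "e \<notin> span B"
    using insert.prems insert.hyps by (auto simp: independent_insert split: if_splits)
  obtain \<phi> where bl: "\<And>b. b \<in> B \<Longrightarrow> bounded_linear (\<phi> b :: 'a \<Rightarrow> real)"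
    and bi: "\<And>b c. b \<in> B \<Longrightarrow> c \<in> B \<Longrightarrow> \<phi> b c = (if b = c then 1 else 0)"
    using insert.IH[OF ind(1)] by blast
  define e' where "e' = e - (\<Sum>b\<in>B. \<phi> b e *\<^sub>R b)"
  have "(\<Sum>b\<in>B. \<phi> b e *\<^sub>R b) \<in> span B"
    by (intro span_sum span_scale span_base)
  then have "e' \<noteq> 0" using ind(2) by (auto simp: e'_def)
  then obtain f :: "'a \<Rightarrow> real" where f: "bounded_linear f" "f e' \<noteq> 0"
    by (rule bounded_linear_separating)
  interpret f: bounded_linear f by (rule f(1))
  define \<psi> where "\<psi> x = (f x - (\<Sum>b\<in>B. \<phi> b x * f b)) / f e'" for x
  have bl\<psi>: "bounded_linear \<psi>"
    unfolding \<psi>_def divide_inverse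
    by (intro bounded_linear_compose[OF bounded_linear_mult_left] bounded_linear_sub f(1)
        bounded_linear_sum bl)
  have \<psi>e: "\<psi> e = 1"
    using f(2) by (simp add: \<psi>_def e'_def f.diff f.sum f.scaleR)
  have \<psi>B: "\<psi> c = 0" if "c \<in> B" for c
  proof -
    have "(\<Sum>b\<in>B. \<phi> b c * f b) = (\<Sum>b\<in>B. if b = c then f b else 0)"
      using that by (intro sum.cong) (auto simp: bi)
    also have "\<dots> = f c" using that insert.hyps by (simp add: sum.delta')
    finally show ?thesis by (simp add: \<psi>_def)
  qed
  define \<phi>' where "\<phi>' b = (if b = e then \<psi> else (\<lambda>x. \<phi> b x - \<phi> b e * \<psi> x))" for b
  have "\<forall>b\<in>insert e B. bounded_linear (\<phi>' b)"
    using bl bl\<psi> by (auto simp: \<phi>'_def intro!: bounded_linear_sub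
        bounded_linear_compose[OF bounded_linear_mult_right])
  moreover have "\<forall>b\<in>insert e B. \<forall>c\<in>insert e B. \<phi>' b c = (if b = c then 1 else 0)"
    using insert.hyps \<psi>e \<psi>B bi by (auto simp: \<phi>'_def)
  ultimately show ?case by blast
qed

lemma finite_rank_fixing:
  fixes S :: "'a::real_normed_vector set"
  assumes "finite S"
  obtains B \<phi> where "finite B" "\<And>b. b \<in> B \<Longrightarrow> bounded_linear (\<phi> b :: 'a \<Rightarrow> real)"
    "\<And>x. x \<in> S \<Longrightarrow> (\<Sum>b\<in>B. \<phi> b x *\<^sub>R b) = x"
proof -
  obtain B where B: "B \<subseteq> S" "independent B" "S \<subseteq> span B"
    using maximal_independent_subset[of S] by blast
  have fin: "finite B" using B(1) assms finite_subset by blast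
  obtain \<phi> where \<phi>: "\<And>b. b \<in> B \<Longrightarrow> bounded_linear (\<phi> b :: 'a \<Rightarrow> real)"
    and bi: "\<And>b c. b \<in> B \<Longrightarrow> c \<in> B \<Longrightarrow> \<phi> b c = (if b = c then 1 else 0)"
    using biorthogonal_functionals[OF fin B(2)] by blast
  have lin: "linear (\<lambda>x. \<Sum>b\<in>B. \<phi> b x *\<^sub>R b)"
    by (intro bounded_linear.linear bounded_linear_sum
        bounded_linear_compose[OF bounded_linear_scaleR_left] \<phi>)
  have "(\<Sum>b\<in>B. \<phi> b x *\<^sub>R b) = x" if "x \<in> B" for x
  proof -
    have "(\<Sum>b\<in>B. \<phi> b x *\<^sub>R b) = (\<Sum>b\<in>B. if b = x then b else 0)"
      using that by (intro sum.cong) (auto simp: bi)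
    also have "\<dots> = x" using that fin by (simp add: sum.delta')
    finally show ?thesis .
  qed
  then have "(\<Sum>b\<in>B. \<phi> b x *\<^sub>R b) = x" if "x \<in> S" for x
    using linear_eq_on_span[OF lin linear_ident, of B x] that B(3) by blast
  then show ?thesis using that fin \<phi> by blast
qed


section \<open>The algebraic tensor product\<close>

text \<open>
  A list of pairs stands for the finite sum of the elementary tensors of its entries (scalars are
  absorbed into the first factors). Two such sums are the same tensor iff all bilinear forms,
  bounded or not, take the same value on them.
\<close>

definition form_sum :: "('a \<Rightarrow> 'b \<Rightarrow> real) \<Rightarrow> ('a \<times> 'b) list \<Rightarrow> real" where
  "form_sum A u = (\<Sum>(x, y)\<leftarrow>u. A x y)"

definition tensor_eq ::
  "('a::real_vector \<times> 'b::real_vector) list \<Rightarrow> ('a \<times> 'b) list \<Rightarrow> bool" where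
  "tensor_eq u v \<longleftrightarrow> (\<forall>A. bilinear A \<longrightarrow> form_sum A u = form_sum A v)"

definition scale_first :: "real \<Rightarrow> ('a::real_vector \<times> 'b) list \<Rightarrow> ('a \<times> 'b) list" where
  "scale_first r u = map (\<lambda>(x, y). (r *\<^sub>R x, y)) u"

lemma form_sum_simps [simp]:
  "form_sum A [] = 0" "form_sum A ((x, y) # u) = A x y + form_sum A u"
  "form_sum A (u @ v) = form_sum A u + form_sum A v"
  by (simp_all add: form_sum_def)

lemma form_sum_scale [simp]: "bilinear A \<Longrightarrow> form_sum A (scale_first r u) = r * form_sum A u"
  by (induction u) (auto simp: scale_first_def bilinear_lmul algebra_simps)

quotient_type (overloaded) ('a, 'b) tensor =
  "('a::real_vector \<times> 'b::real_vector) list" / tensor_eq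
  by (auto intro!: equivpI reflpI sympI transpI simp: tensor_eq_def)

instantiation tensor :: (real_vector, real_vector) real_vector
begin

lift_definition zero_tensor :: "('a, 'b) tensor" is "[]" .

lift_definition plus_tensor :: "('a, 'b) tensor \<Rightarrow> ('a, 'b) tensor \<Rightarrow> ('a, 'b) tensor" is "(@)"
  by (simp add: tensor_eq_def)

lift_definition scaleR_tensor :: "real \<Rightarrow> ('a, 'b) tensor \<Rightarrow> ('a, 'b) tensor" is scale_first
  by (simp add: tensor_eq_def)

lift_definition uminus_tensor :: "('a, 'b) tensor \<Rightarrow> ('a, 'b) tensor" is "scale_first (- 1)"
  by (simp add: tensor_eq_def)

definition minus_tensor :: "('a, 'b) tensor \<Rightarrow> ('a, 'b) tensor \<Rightarrow> ('a, 'b) tensor" where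
  "minus_tensor u v = u + - v"

instance
  by standard
    (simp_all add: minus_tensor_def, (transfer, simp add: tensor_eq_def algebra_simps)+)

end

lift_definition elem_tensor :: "'a::real_vector \<Rightarrow> 'b::real_vector \<Rightarrow> ('a, 'b) tensor"
  is "\<lambda>x y. [(x, y)]" .


section \<open>The projective norm\<close>

definition rep_cost :: "('a::real_normed_vector \<times> 'b::real_normed_vector) list \<Rightarrow> real" where
  "rep_cost u = (\<Sum>(x, y)\<leftarrow>u. norm x * norm y)"

lemma rep_cost_simps [simp]:
  "rep_cost [] = 0" "rep_cost ((x, y) # u) = norm x * norm y + rep_cost u"
  "rep_cost (u @ v) = rep_cost u + rep_cost v"
  by (simp_all add: rep_cost_def)

lemma rep_cost_scale [simp]: "rep_cost (scale_first r u) = \<bar>r\<bar> * rep_cost u"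
  by (induction u) (auto simp: scale_first_def algebra_simps)

lemma rep_cost_nonneg: "0 \<le> rep_cost u"
  by (induction u) auto

text \<open>The infimum of the sums of \<open>norm x * norm y\<close> over all representations of the tensor.\<close>

lift_definition projective_norm ::
  "('a::real_normed_vector, 'b::real_normed_vector) tensor \<Rightarrow> real"
  is "\<lambda>u. Inf {rep_cost v | v. tensor_eq u v}"
  by (simp add: tensor_eq_def)

lemma projective_norm_le: "projective_norm (abs_tensor u) \<le> rep_cost u"
proof (transfer fixing: u)
  show "Inf {rep_cost v | v. tensor_eq u v} \<le> rep_cost u"
    by (rule cInf_lower) (auto simp: tensor_eq_def intro!: bdd_belowI[of _ 0] rep_cost_nonneg)
qed

lemma projective_norm_ge:
  assumes "\<And>u. z = abs_tensor u \<Longrightarrow> c \<le> rep_cost u"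
  shows "c \<le> projective_norm z"
  using assms
proof (transfer fixing: c)
  fix z :: "('a \<times> 'b) list"
  assume "\<And>u. tensor_eq z u \<Longrightarrow> c \<le> rep_cost u"
  moreover have "tensor_eq z z" by (simp add: tensor_eq_def)
  ultimately show "c \<le> Inf {rep_cost v | v. tensor_eq z v}"
    by (intro cInf_greatest) auto
qed

lemma projective_norm_nonneg: "0 \<le> projective_norm z"
  by (intro projective_norm_ge rep_cost_nonneg)

lemma abs_tensor_append: "abs_tensor (u @ v) = abs_tensor u + abs_tensor v"
  by (simp add: plus_tensor.abs_eq)

lemma abs_tensor_scale: "abs_tensor (scale_first r u) = r *\<^sub>R abs_tensor u"
  by (simp add: scaleR_tensor.abs_eq)

lemma projective_norm_triangle: "projective_norm (z + w) \<le> projective_norm z + projective_norm w"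
proof -
  have "projective_norm (z + w) - projective_norm w \<le> projective_norm z"
  proof (rule projective_norm_ge)
    fix u assume u: "z = abs_tensor u"
    have "projective_norm (z + w) - rep_cost u \<le> projective_norm w"
    proof (rule projective_norm_ge)
      fix v assume v: "w = abs_tensor v"
      show "projective_norm (z + w) - rep_cost u \<le> rep_cost v"
        using projective_norm_le[of "u @ v"] by (simp add: u v abs_tensor_append)
    qed
    then show "projective_norm (z + w) - projective_norm w \<le> rep_cost u" by simp
  qed
  then show ?thesis by simp
qed

lemma projective_norm_scale_le: "projective_norm (r *\<^sub>R z) \<le> \<bar>r\<bar> * projective_norm z"
proof (cases "r = 0")
  case True
  have "projective_norm (0 :: ('a, 'b) tensor) \<le> 0"
    using projective_norm_le[of "[] :: ('a \<times> 'b) list"] by (simp add: zero_tensor_def)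
  with True show ?thesis by simp
next
  case False
  have "projective_norm (r *\<^sub>R z) / \<bar>r\<bar> \<le> projective_norm z"
  proof (rule projective_norm_ge)
    fix u assume "z = abs_tensor u"
    then show "projective_norm (r *\<^sub>R z) / \<bar>r\<bar> \<le> rep_cost u"
      using projective_norm_le[of "scale_first r u"] False
      by (simp add: abs_tensor_scale field_simps)
  qed
  then show ?thesis using False by (simp add: field_simps)
qed

lemma projective_norm_scale: "projective_norm (r *\<^sub>R z) = \<bar>r\<bar> * projective_norm z"
proof (cases "r = 0")
  case True
  then show ?thesis using projective_norm_scale_le[of r z] projective_norm_nonneg[of "r *\<^sub>R z"]
    by simp
next
  case False
  have "projective_norm (inverse r *\<^sub>R r *\<^sub>R z) \<le> \<bar>inverse r\<bar> * projective_norm (r *\<^sub>R z)"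
    by (rule projective_norm_scale_le)
  then have "\<bar>r\<bar> * projective_norm z \<le> projective_norm (r *\<^sub>R z)"
    using False by (simp add: field_simps abs_inverse)
  with projective_norm_scale_le[of r z] show ?thesis by simp
qed

lemma bounded_form_sum_le:
  assumes K: "\<And>x y. \<bar>A x y\<bar> \<le> K * (norm x * norm y)"
  shows "\<bar>form_sum A u\<bar> \<le> K * rep_cost u"
proof (induction u)
  case (Cons p u)
  obtain x y where "p = (x, y)" by force
  then show ?case using Cons K[of x y] by (simp add: distrib_left)
qed simp

lemma projective_norm_eq_0_imp:
  fixes z :: "('a::real_normed_vector, 'b::real_normed_vector) tensor"
  assumes z: "projective_norm z = 0"
  shows "z = 0"
proof -
  obtain u where u: "z = abs_tensor u" by (metis Quotient_rep_abs_eq Quotient3_abs_rep Quotient3_tensor)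
  have bnd: "form_sum A u = 0" if A: "bounded_bilinear A" for A :: "'a \<Rightarrow> 'b \<Rightarrow> real"
  proof -
    interpret A: bounded_bilinear A by (rule A)
    obtain K where K: "K > 0" "\<And>x y. \<bar>A x y\<bar> \<le> norm x * norm y * K"
      using A.pos_bounded by (auto simp: real_norm_def)
    have K': "\<bar>A x y\<bar> \<le> K * (norm x * norm y)" for x y using K(2)[of x y] by (simp add: mult_ac)
    have bil: "bilinear A"
      by (simp add: A.add_left A.add_right A.scaleR_left A.scaleR_right bilinear_def linear_iff)
    have "\<bar>form_sum A u\<bar> / K \<le> projective_norm z"
    proof (rule projective_norm_ge)
      fix v assume "z = abs_tensor v"
      then have "tensor_eq u v" using u by (simp add: tensor.abs_eq_iff)
      then have "form_sum A u = form_sum A v" using bil by (simp add: tensor_eq_def)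
      then show "\<bar>form_sum A u\<bar> / K \<le> rep_cost v"
        using bounded_form_sum_le[OF K', of v] K(1) by (simp add: field_simps)
    qed
    with z K(1) show ?thesis by (simp add: field_simps)
  qed
  have "form_sum A u = 0" if A: "bilinear A" for A :: "'a \<Rightarrow> 'b \<Rightarrow> real"
  proof -
    obtain B \<phi> where B: "finite B" "\<And>b. b \<in> B \<Longrightarrow> bounded_linear (\<phi> b :: 'a \<Rightarrow> real)"
      "\<And>x. x \<in> fst ` set u \<Longrightarrow> (\<Sum>b\<in>B. \<phi> b x *\<^sub>R b) = x"
      using finite_rank_fixing[of "fst ` set u"] by blast
    obtain C \<psi> where C: "finite C" "\<And>c. c \<in> C \<Longrightarrow> bounded_linear (\<psi> c :: 'b \<Rightarrow> real)"
      "\<And>y. y \<in> snd ` set u \<Longrightarrow> (\<Sum>c\<in>C. \<psi> c y *\<^sub>R c) = y"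
      using finite_rank_fixing[of "snd ` set u"] by blast
    define A' where "A' x y = (\<Sum>b\<in>B. \<Sum>c\<in>C. \<phi> b x * \<psi> c y * A b c)" for x y
    have A': "A' x y = A (\<Sum>b\<in>B. \<phi> b x *\<^sub>R b) (\<Sum>c\<in>C. \<psi> c y *\<^sub>R c)" for x y
      unfolding A'_def bilinear_sum[OF A] sum.cartesian_product
      by (intro sum.cong) (auto simp: bilinear_lmul[OF A] bilinear_rmul[OF A])
    have one: "\<exists>K\<ge>0. \<forall>x y. \<bar>\<phi> b x * \<psi> c y * A b c\<bar> \<le> norm x * norm y * K"
      if bc: "b \<in> B" "c \<in> C" for b c
    proof -
      obtain K1 where K1: "K1 \<ge> 0" "\<And>x. \<bar>\<phi> b x\<bar> \<le> norm x * K1"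
        using bounded_linear.nonneg_bounded[OF B(2)[OF bc(1)]] by auto
      obtain K2 where K2: "K2 \<ge> 0" "\<And>x. \<bar>\<psi> c x\<bar> \<le> norm x * K2"
        using bounded_linear.nonneg_bounded[OF C(2)[OF bc(2)]] by auto
      have "\<bar>\<phi> b x * \<psi> c y * A b c\<bar> \<le> norm x * norm y * (K1 * K2 * \<bar>A b c\<bar>)" for x y
      proof -
        have "\<bar>\<phi> b x\<bar> * \<bar>\<psi> c y\<bar> \<le> (norm x * K1) * (norm y * K2)"
          using K1 K2 by (intro mult_mono) auto
        then have "\<bar>\<phi> b x\<bar> * \<bar>\<psi> c y\<bar> * \<bar>A b c\<bar> \<le> (norm x * K1) * (norm y * K2) * \<bar>A b c\<bar>"
          by (intro mult_right_mono) auto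
        then show ?thesis by (simp add: abs_mult mult_ac)
      qed
      then show ?thesis using K1 K2 by (intro exI[of _ "K1 * K2 * \<bar>A b c\<bar>"]) auto
    qed
    then obtain K where K: "\<And>b c x y. b \<in> B \<Longrightarrow> c \<in> C \<Longrightarrow>
        \<bar>\<phi> b x * \<psi> c y * A b c\<bar> \<le> norm x * norm y * K b c"
      by metis
    have "\<bar>A' x y\<bar> \<le> norm x * norm y * (\<Sum>b\<in>B. \<Sum>c\<in>C. K b c)" for x y
      unfolding A'_def sum_distrib_left
      by (intro order_trans[OF sum_abs] sum_mono K)
    moreover have "linear (A' x)" for x
      unfolding A'_def
      by (intro bounded_linear.linear bounded_linear_sum
          bounded_linear_compose[OF bounded_linear_mult_left]
          bounded_linear_compose[OF bounded_linear_mult_right] C(2))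
    moreover have "linear (\<lambda>x. A' x y)" for y
      unfolding A'_def
      by (intro bounded_linear.linear bounded_linear_sum
          bounded_linear_compose[OF bounded_linear_mult_left] B(2))
    ultimately have "bounded_bilinear A'"
      unfolding bounded_bilinear_def by (auto simp: linear_iff)
    then have "form_sum A' u = 0" by (rule bnd)
    moreover have "form_sum A' u = form_sum A u"
    proof -
      have "map (\<lambda>(x, y). A' x y) u = map (\<lambda>(x, y). A x y) u"
      proof (rule map_cong[OF refl])
        fix p assume p: "p \<in> set u"
        obtain x y where xy: "p = (x, y)" by force
        have "x \<in> fst ` set u" "y \<in> snd ` set u" using p xy by force+
        then show "(case p of (x, y) \<Rightarrow> A' x y) = (case p of (x, y) \<Rightarrow> A x y)"
          by (simp add: xy A' B(3) C(3))
      qed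
      then show ?thesis by (simp only: form_sum_def)
    qed
    ultimately show ?thesis by simp
  qed
  then have "tensor_eq u []" by (simp add: tensor_eq_def)
  then show ?thesis by (simp add: u zero_tensor_def tensor.abs_eq_iff)
qed

instantiation tensor :: (real_normed_vector, real_normed_vector) real_normed_vector
begin

definition norm_tensor :: "('a, 'b) tensor \<Rightarrow> real" where
  "norm_tensor = projective_norm"

definition dist_tensor :: "('a, 'b) tensor \<Rightarrow> ('a, 'b) tensor \<Rightarrow> real" where
  "dist_tensor u v = norm (u - v)"

definition sgn_tensor :: "('a, 'b) tensor \<Rightarrow> ('a, 'b) tensor" where
  "sgn_tensor u = inverse (norm u) *\<^sub>R u"

definition uniformity_tensor :: "(('a, 'b) tensor \<times> ('a, 'b) tensor) filter" where
  "uniformity_tensor = (INF e\<in>{0 <..}. principal {(x, y). dist x y < e})"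

definition open_tensor :: "('a, 'b) tensor set \<Rightarrow> bool" where
  "open_tensor S = (\<forall>x\<in>S. \<forall>\<^sub>F (x', y) in uniformity. x' = x \<longrightarrow> y \<in> S)"

instance
proof
  fix u v :: "('a, 'b) tensor" and r :: real
  show "(norm u = 0) = (u = 0)"
    using projective_norm_eq_0_imp[of u] projective_norm_scale[of 0 u] by (auto simp: norm_tensor_def)
qed (simp_all add: dist_tensor_def sgn_tensor_def uniformity_tensor_def open_tensor_def
    norm_tensor_def projective_norm_triangle projective_norm_scale)

end


section \<open>Completion of a normed space\<close>

text \<open>Cauchy sequences modulo null sequences, normed by the limit of the norms.\<close>

definition cauchy_eq :: "(nat \<Rightarrow> 'a::real_normed_vector) \<Rightarrow> (nat \<Rightarrow> 'a) \<Rightarrow> bool" where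
  "cauchy_eq X Y \<longleftrightarrow> Cauchy X \<and> Cauchy Y \<and> (\<lambda>n. X n - Y n) \<longlonglongrightarrow> 0"

lemma part_equivp_cauchy_eq:
  "part_equivp (cauchy_eq :: (nat \<Rightarrow> 'a::real_normed_vector) \<Rightarrow> _ \<Rightarrow> bool)"
proof (rule part_equivpI)
  show "\<exists>X :: nat \<Rightarrow> 'a. cauchy_eq X X"
    by (rule exI[of _ "\<lambda>_. 0"]) (simp add: cauchy_eq_def convergent_Cauchy convergent_const)
  show "symp (cauchy_eq :: (nat \<Rightarrow> 'a) \<Rightarrow> _)"
  proof (rule sympI)
    fix X Y :: "nat \<Rightarrow> 'a" assume "cauchy_eq X Y"
    then show "cauchy_eq Y X"
      unfolding cauchy_eq_def using tendsto_minus[of "\<lambda>n. X n - Y n" 0 sequentially] by simp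
  qed
  show "transp (cauchy_eq :: (nat \<Rightarrow> 'a) \<Rightarrow> _)"
  proof (rule transpI)
    fix X Y Z :: "nat \<Rightarrow> 'a" assume "cauchy_eq X Y" "cauchy_eq Y Z"
    then show "cauchy_eq X Z"
      unfolding cauchy_eq_def
      using tendsto_add[of "\<lambda>n. X n - Y n" 0 sequentially "\<lambda>n. Y n - Z n" 0] by simp
  qed
qed

quotient_type (overloaded) 'a cauchy_completion =
  "nat \<Rightarrow> 'a::real_normed_vector" / partial: cauchy_eq
  by (rule part_equivp_cauchy_eq)

lemma Cauchy_norm_diff:
  fixes X :: "nat \<Rightarrow> 'a::real_normed_vector"
  shows "Cauchy X \<longleftrightarrow> (\<forall>e>0. \<exists>M. \<forall>m\<ge>M. \<forall>n\<ge>M. norm (X m - X n) < e)"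
  by (simp add: Cauchy_def dist_norm)

lemma Cauchy_plus:
  fixes X Y :: "nat \<Rightarrow> 'a::real_normed_vector"
  assumes "Cauchy X" "Cauchy Y" shows "Cauchy (\<lambda>n. X n + Y n)"
  unfolding Cauchy_norm_diff
proof (intro allI impI)
  fix e :: real assume e: "e > 0"
  obtain M where M: "\<And>m n. m \<ge> M \<Longrightarrow> n \<ge> M \<Longrightarrow> norm (X m - X n) < e / 2"
    using assms(1) e unfolding Cauchy_norm_diff by (meson half_gt_zero)
  obtain N where N: "\<And>m n. m \<ge> N \<Longrightarrow> n \<ge> N \<Longrightarrow> norm (Y m - Y n) < e / 2"
    using assms(2) e unfolding Cauchy_norm_diff by (meson half_gt_zero)
  have "norm (X m + Y m - (X n + Y n)) < e" if "m \<ge> max M N" "n \<ge> max M N" for m n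
  proof -
    have eq: "X m + Y m - (X n + Y n) = (X m - X n) + (Y m - Y n)" by simp
    have "norm (X m - X n) < e / 2" "norm (Y m - Y n) < e / 2"
      using M[of m n] N[of m n] that by auto
    then show ?thesis
      unfolding eq using norm_triangle_ineq[of "X m - X n" "Y m - Y n"] by linarith
  qed
  then show "\<exists>M. \<forall>m\<ge>M. \<forall>n\<ge>M. norm (X m + Y m - (X n + Y n)) < e" by blast
qed

lemma Cauchy_scale:
  fixes X :: "nat \<Rightarrow> 'a::real_normed_vector"
  assumes "Cauchy X" shows "Cauchy (\<lambda>n. r *\<^sub>R X n)"
  by (rule bounded_linear.Cauchy[OF bounded_linear_scaleR_right assms])

lemma Cauchy_norm_convergent:
  fixes X :: "nat \<Rightarrow> 'a::real_normed_vector"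
  assumes "Cauchy X" shows "(\<lambda>n. norm (X n)) \<longlonglongrightarrow> lim (\<lambda>n. norm (X n))"
proof -
  have "Cauchy (\<lambda>n. norm (X n))"
    unfolding Cauchy_norm_diff real_norm_def
    using assms unfolding Cauchy_norm_diff by (meson norm_triangle_ineq3 le_less_trans)
  then show ?thesis by (simp add: Cauchy_convergent_iff convergent_LIMSEQ_iff)
qed

instantiation cauchy_completion :: (real_normed_vector) real_normed_vector
begin

lift_definition zero_cauchy_completion :: "'a cauchy_completion" is "\<lambda>_. 0"
  by (simp add: cauchy_eq_def convergent_Cauchy convergent_const)

lift_definition plus_cauchy_completion ::
  "'a cauchy_completion \<Rightarrow> 'a cauchy_completion \<Rightarrow> 'a cauchy_completion"
  is "\<lambda>X Y n. X n + Y n"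
proof -
  fix X X' Y Y' :: "nat \<Rightarrow> 'a"
  assume a: "cauchy_eq X X'" "cauchy_eq Y Y'"
  then have "(\<lambda>n. (X n - X' n) + (Y n - Y' n)) \<longlonglongrightarrow> 0 + 0"
    unfolding cauchy_eq_def by (intro tendsto_add) auto
  with a show "cauchy_eq (\<lambda>n. X n + Y n) (\<lambda>n. X' n + Y' n)"
    by (simp add: cauchy_eq_def Cauchy_plus algebra_simps)
qed

lift_definition scaleR_cauchy_completion ::
  "real \<Rightarrow> 'a cauchy_completion \<Rightarrow> 'a cauchy_completion" is "\<lambda>r X n. r *\<^sub>R X n"
proof -
  fix r and X X' :: "nat \<Rightarrow> 'a"
  assume a: "cauchy_eq X X'"
  then have "(\<lambda>n. r *\<^sub>R (X n - X' n)) \<longlonglongrightarrow> r *\<^sub>R 0"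
    unfolding cauchy_eq_def by (intro tendsto_intros) auto
  with a show "cauchy_eq (\<lambda>n. r *\<^sub>R X n) (\<lambda>n. r *\<^sub>R X' n)"
    by (simp add: cauchy_eq_def Cauchy_scale algebra_simps)
qed

definition uminus_cauchy_completion :: "'a cauchy_completion \<Rightarrow> 'a cauchy_completion" where
  "uminus_cauchy_completion z = (- 1) *\<^sub>R z"

definition minus_cauchy_completion ::
  "'a cauchy_completion \<Rightarrow> 'a cauchy_completion \<Rightarrow> 'a cauchy_completion" where
  "minus_cauchy_completion z w = z + (- 1) *\<^sub>R w"

lift_definition norm_cauchy_completion :: "'a cauchy_completion \<Rightarrow> real"
  is "\<lambda>X. lim (\<lambda>n. norm (X n))"
proof -
  fix X Y :: "nat \<Rightarrow> 'a" assume a: "cauchy_eq X Y"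
  have "(\<lambda>n. norm (X n) - norm (Y n)) \<longlonglongrightarrow> 0"
    by (rule Lim_null_comparison[where g = "\<lambda>n. norm (X n - Y n)"])
      (use a in \<open>auto simp: cauchy_eq_def norm_triangle_ineq3 tendsto_norm_zero\<close>)
  moreover have "(\<lambda>n. norm (X n) - norm (Y n)) \<longlonglongrightarrow> lim (\<lambda>n. norm (X n)) - lim (\<lambda>n. norm (Y n))"
    using a by (intro tendsto_diff Cauchy_norm_convergent) (auto simp: cauchy_eq_def)
  ultimately show "lim (\<lambda>n. norm (X n)) = lim (\<lambda>n. norm (Y n))"
    using LIMSEQ_unique by force
qed

definition dist_cauchy_completion :: "'a cauchy_completion \<Rightarrow> 'a cauchy_completion \<Rightarrow> real" where
  "dist_cauchy_completion z w = norm (z - w)"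

definition sgn_cauchy_completion :: "'a cauchy_completion \<Rightarrow> 'a cauchy_completion" where
  "sgn_cauchy_completion z = inverse (norm z) *\<^sub>R z"

definition uniformity_cauchy_completion ::
  "('a cauchy_completion \<times> 'a cauchy_completion) filter" where
  "uniformity_cauchy_completion = (INF e\<in>{0 <..}. principal {(x, y). dist x y < e})"

definition open_cauchy_completion :: "'a cauchy_completion set \<Rightarrow> bool" where
  "open_cauchy_completion S = (\<forall>x\<in>S. \<forall>\<^sub>F (x', y) in uniformity. x' = x \<longrightarrow> y \<in> S)"

instance
proof
  fix a b c z w :: "'a cauchy_completion" and r s :: real
  show "a + b + c = a + (b + c)"
    by transfer (auto simp: cauchy_eq_def algebra_simps intro!: Cauchy_plus)
  show "a + b = b + a"
    by transfer (auto simp: cauchy_eq_def algebra_simps intro!: Cauchy_plus)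
  show "0 + a = a"
    by transfer (auto simp: cauchy_eq_def)
  show "- a + a = 0"
    unfolding uminus_cauchy_completion_def
    by transfer (auto simp: cauchy_eq_def convergent_Cauchy convergent_const)
  show "a - b = a + - b"
    by (simp add: uminus_cauchy_completion_def minus_cauchy_completion_def)
  show "r *\<^sub>R (a + b) = r *\<^sub>R a + r *\<^sub>R b"
    by transfer (auto simp: cauchy_eq_def algebra_simps intro!: Cauchy_plus Cauchy_scale)
  show "(r + s) *\<^sub>R a = r *\<^sub>R a + s *\<^sub>R a"
    by transfer (auto simp: cauchy_eq_def algebra_simps intro!: Cauchy_plus Cauchy_scale)
  show "r *\<^sub>R s *\<^sub>R a = (r * s) *\<^sub>R a"
    by transfer (auto simp: cauchy_eq_def intro!: Cauchy_scale)
  show "1 *\<^sub>R a = a"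
    by transfer (auto simp: cauchy_eq_def)
  show "(norm z = 0) = (z = 0)"
  proof (transfer, goal_cases)
    case (1 X)
    then have C: "Cauchy X" by (simp add: cauchy_eq_def)
    note L = Cauchy_norm_convergent[OF C]
    show ?case
    proof
      assume "lim (\<lambda>n. norm (X n)) = 0"
      with L have "X \<longlonglongrightarrow> 0" by (simp add: tendsto_norm_zero_iff)
      with C show "cauchy_eq X (\<lambda>_. 0)"
        by (simp add: cauchy_eq_def convergent_Cauchy convergent_const)
    next
      assume "cauchy_eq X (\<lambda>_. 0)"
      then have "(\<lambda>n. norm (X n)) \<longlonglongrightarrow> 0" by (simp add: cauchy_eq_def tendsto_norm_zero)
      then show "lim (\<lambda>n. norm (X n)) = 0" by (rule limI)
    qed
  qed
  show "norm (z + w) \<le> norm z + norm w"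
  proof (transfer, goal_cases)
    case (1 X Y)
    then have C: "Cauchy X" "Cauchy Y" by (simp_all add: cauchy_eq_def)
    show ?case
      by (rule LIMSEQ_le[OF Cauchy_norm_convergent[OF Cauchy_plus[OF C]]
            tendsto_add[OF Cauchy_norm_convergent[OF C(1)] Cauchy_norm_convergent[OF C(2)]]])
        (auto intro: norm_triangle_ineq)
  qed
  show "norm (r *\<^sub>R z) = \<bar>r\<bar> * norm z"
  proof (transfer, goal_cases)
    case (1 r X)
    then have C: "Cauchy X" by (simp add: cauchy_eq_def)
    show ?case
      using tendsto_mult_left[OF Cauchy_norm_convergent[OF C], of "\<bar>r\<bar>"] by (simp add: limI)
  qed
qed (simp_all add: dist_cauchy_completion_def sgn_cauchy_completion_def
    uniformity_cauchy_completion_def open_cauchy_completion_def)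

end

lift_definition to_completion :: "'a::real_normed_vector \<Rightarrow> 'a cauchy_completion" is "\<lambda>x _. x"
  by (simp add: cauchy_eq_def convergent_Cauchy convergent_const)

lemma linear_to_completion: "linear to_completion"
proof (rule linearI)
  show "to_completion (x + y) = to_completion x + to_completion y" for x y :: 'a
    by transfer (simp add: cauchy_eq_def convergent_Cauchy convergent_const)
  show "to_completion (r *\<^sub>R x) = r *\<^sub>R to_completion x" for r and x :: 'a
    by transfer (simp add: cauchy_eq_def convergent_Cauchy convergent_const)
qed

lemma norm_to_completion [simp]: "norm (to_completion x) = norm x"
  by transfer (simp add: limI)

lemma to_completion_tendsto:
  fixes X :: "nat \<Rightarrow> 'a::real_normed_vector"
  assumes C: "Cauchy X"
  shows "(\<lambda>n. to_completion (X n)) \<longlonglongrightarrow> abs_cauchy_completion X"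
proof (rule LIMSEQ_I)
  fix e :: real assume e: "e > 0"
  obtain M where M: "\<And>m n. m \<ge> M \<Longrightarrow> n \<ge> M \<Longrightarrow> norm (X m - X n) < e / 2"
    using C e unfolding Cauchy_norm_diff by (meson half_gt_zero)
  have "norm (to_completion (X n) - abs_cauchy_completion X) < e" if n: "n \<ge> M" for n
  proof -
    have c: "cauchy_eq X X" "cauchy_eq (\<lambda>_. X n) (\<lambda>_. X n)"
      using C by (simp_all add: cauchy_eq_def convergent_Cauchy convergent_const)
    have C': "Cauchy (\<lambda>k. X n - X k)"
      using Cauchy_plus[OF _ Cauchy_scale[OF C, of "- 1"], of "\<lambda>_. X n"]
      by (simp add: convergent_Cauchy convergent_const)
    have c': "cauchy_eq (\<lambda>k. - 1 *\<^sub>R X k) (\<lambda>k. - 1 *\<^sub>R X k)"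
      using Cauchy_scale[OF C, of "- 1"] by (simp add: cauchy_eq_def)
    have "to_completion (X n) - abs_cauchy_completion X =
        abs_cauchy_completion (\<lambda>_. X n) + abs_cauchy_completion (\<lambda>k. - 1 *\<^sub>R X k)"
      unfolding minus_cauchy_completion_def scaleR_cauchy_completion.abs_eq[OF c(1)]
        to_completion.abs_eq by (rule refl)
    also have "\<dots> = abs_cauchy_completion (\<lambda>k. X n + - 1 *\<^sub>R X k)"
      by (rule plus_cauchy_completion.abs_eq[OF c(2) c'])
    finally have eq: "to_completion (X n) - abs_cauchy_completion X =
        abs_cauchy_completion (\<lambda>k. X n - X k)" by simp
    have "norm (abs_cauchy_completion (\<lambda>k. X n - X k)) = lim (\<lambda>k. norm (X n - X k))"
      using C' by (intro norm_cauchy_completion.abs_eq) (simp add: cauchy_eq_def)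
    also have "\<dots> \<le> e / 2"
    proof (rule LIMSEQ_le_const2[OF Cauchy_norm_convergent[OF C']])
      show "\<exists>N. \<forall>k\<ge>N. norm (X n - X k) \<le> e / 2"
        using M[OF n] by (intro exI[of _ M]) (auto intro: less_imp_le)
    qed
    finally show ?thesis using e by (simp add: eq)
  qed
  then show "\<exists>N. \<forall>n\<ge>N. norm (to_completion (X n) - abs_cauchy_completion X) < e" by blast
qed

lemma cauchy_completion_cases:
  obtains X where "Cauchy X" "z = abs_cauchy_completion X"
proof -
  have "Quotient3 cauchy_eq abs_cauchy_completion rep_cauchy_completion"
    by (rule Quotient3_cauchy_completion)
  then show ?thesis
    by (metis Quotient3_abs_rep Quotient3_rep_reflp cauchy_eq_def that)
qed

lemma closure_range_to_completion: "closure (range to_completion) = UNIV"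
proof -
  have "z \<in> closure (range to_completion)" for z :: "'a cauchy_completion"
  proof -
    obtain X where "Cauchy X" "z = abs_cauchy_completion X" by (rule cauchy_completion_cases)
    then show ?thesis
      using to_completion_tendsto[of X] unfolding closure_sequential
      by (intro exI[of _ "\<lambda>n. to_completion (X n)"]) auto
  qed
  then show ?thesis by blast
qed

instance cauchy_completion :: (real_normed_vector) banach
proof
  fix F :: "nat \<Rightarrow> 'a cauchy_completion" assume F: "Cauchy F"
  interpret T: linear "to_completion :: 'a \<Rightarrow> _" by (rule linear_to_completion)
  have "\<exists>x. norm (F n - to_completion x) < inverse (real (Suc n))" for n
  proof -
    have "F n \<in> closure (range to_completion)" by (simp add: closure_range_to_completion)
    moreover have "inverse (real (Suc n)) > 0" by simp
    ultimately have "\<exists>y\<in>range to_completion. dist y (F n) < inverse (real (Suc n))"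
      unfolding closure_approachable by blast
    then obtain x where "dist (to_completion x) (F n) < inverse (real (Suc n))" by blast
    then have "norm (F n - to_completion x) < inverse (real (Suc n))"
      by (simp only: dist_norm norm_minus_commute)
    then show ?thesis by blast
  qed
  then obtain a where a: "\<And>n. norm (F n - to_completion (a n)) < inverse (real (Suc n))"
    by metis
  have lim0: "(\<lambda>n. F n - to_completion (a n)) \<longlonglongrightarrow> 0"
    by (rule Lim_null_comparison[OF _ LIMSEQ_inverse_real_of_nat])
      (use a in \<open>auto intro: less_imp_le always_eventually\<close>)
  have "Cauchy (\<lambda>n. F n + (- 1) *\<^sub>R (F n - to_completion (a n)))"
    using lim0 by (intro Cauchy_plus[OF F] Cauchy_scale LIMSEQ_imp_Cauchy)
  then have "Cauchy (\<lambda>n. to_completion (a n))" by simp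
  then have "Cauchy a"
    by (simp add: Cauchy_norm_diff T.diff[symmetric])
  from tendsto_add[OF lim0 to_completion_tendsto[OF this]]
  show "convergent F" by (auto intro: convergentI)
qed


section \<open>The projective tensor product\<close>

type_synonym ('a, 'b) projective_tensor = "('a, 'b) tensor cauchy_completion"

definition ptensor ::
  "'a::real_normed_vector \<Rightarrow> 'b::real_normed_vector \<Rightarrow> ('a, 'b) projective_tensor"
  (infixl \<open>\<otimes>\<^sub>\<pi>\<close> 70) where
  "x \<otimes>\<^sub>\<pi> y = to_completion (elem_tensor x y)"

text \<open>The set of elementary tensors only; no linear span is taken.\<close>

definition set_ptensor ::
  "'a::real_normed_vector set \<Rightarrow> 'b::real_normed_vector set \<Rightarrow> ('a, 'b) projective_tensor set" where
  "set_ptensor W1 W2 = {x \<otimes>\<^sub>\<pi> y | x y. x \<in> W1 \<and> y \<in> W2}"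


section \<open>Weak sequential notions and operators\<close>

definition weakly_Cauchy :: "(nat \<Rightarrow> 'a::real_normed_vector) \<Rightarrow> bool" where
  "weakly_Cauchy x \<longleftrightarrow> (\<forall>f :: 'a \<Rightarrow>\<^sub>L real. Cauchy (\<lambda>n. blinfun_apply f (x n)))"

definition weakly_null :: "(nat \<Rightarrow> 'a::real_normed_vector) \<Rightarrow> bool" where
  "weakly_null x \<longleftrightarrow> (\<forall>f :: 'a \<Rightarrow>\<^sub>L real. (\<lambda>n. blinfun_apply f (x n)) \<longlonglongrightarrow> 0)"

definition weakly_precompact :: "'a::real_normed_vector set \<Rightarrow> bool" where
  "weakly_precompact W \<longleftrightarrow>
     (\<forall>x :: nat \<Rightarrow> 'a. range x \<subseteq> W \<longrightarrow> (\<exists>r :: nat \<Rightarrow> nat. strict_mono r \<and> weakly_Cauchy (x \<circ> r)))"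

definition dunford_pettis :: "'a::banach itself \<Rightarrow> bool" where
  "dunford_pettis (_ :: 'a itself) \<longleftrightarrow>
     (\<forall>(z :: nat \<Rightarrow> 'a) (f :: nat \<Rightarrow> 'a \<Rightarrow>\<^sub>L real).
        weakly_null z \<longrightarrow> weakly_null f \<longrightarrow> (\<lambda>n. blinfun_apply (f n) (z n)) \<longlonglongrightarrow> 0)"

text \<open>An operator is compact iff the image of the closed unit ball is relatively compact.\<close>

definition compact_operators :: "('a::real_normed_vector \<Rightarrow>\<^sub>L 'b::real_normed_vector) set" where
  "compact_operators = {T. compact (closure (blinfun_apply T ` cball 0 1))}"


section \<open>The space of absolutely summable sequences\<close>

typedef ell1 = "{a :: nat \<Rightarrow> real. summable (\<lambda>n. \<bar>a n\<bar>)}"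
  morphisms ell1_nth Abs_ell1
  by (rule exI[of _ "\<lambda>_. 0"]) simp

setup_lifting type_definition_ell1

lemma abs_summable_add:
  fixes a b :: "nat \<Rightarrow> real"
  assumes "summable (\<lambda>n. \<bar>a n\<bar>)" "summable (\<lambda>n. \<bar>b n\<bar>)"
  shows "summable (\<lambda>n. \<bar>a n + b n\<bar>)"
  by (rule summable_comparison_test'[where N = 0, OF summable_add[OF assms]])
    (simp add: abs_triangle_ineq)

instantiation ell1 :: real_normed_vector
begin

lift_definition zero_ell1 :: ell1 is "\<lambda>_. 0" by simp

lift_definition plus_ell1 :: "ell1 \<Rightarrow> ell1 \<Rightarrow> ell1" is "\<lambda>a b n. a n + b n"
  by (rule abs_summable_add)

lift_definition scaleR_ell1 :: "real \<Rightarrow> ell1 \<Rightarrow> ell1" is "\<lambda>r a n. r * a n"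
  by (simp add: abs_mult summable_mult)

lift_definition uminus_ell1 :: "ell1 \<Rightarrow> ell1" is "\<lambda>a n. - a n" by simp

definition minus_ell1 :: "ell1 \<Rightarrow> ell1 \<Rightarrow> ell1" where "minus_ell1 a b = a + - b"

lift_definition norm_ell1 :: "ell1 \<Rightarrow> real" is "\<lambda>a. \<Sum>n. \<bar>a n\<bar>" .

definition dist_ell1 :: "ell1 \<Rightarrow> ell1 \<Rightarrow> real" where "dist_ell1 a b = norm (a - b)"

definition sgn_ell1 :: "ell1 \<Rightarrow> ell1" where "sgn_ell1 a = inverse (norm a) *\<^sub>R a"

definition uniformity_ell1 :: "(ell1 \<times> ell1) filter" where
  "uniformity_ell1 = (INF e\<in>{0 <..}. principal {(x, y). dist x y < e})"

definition open_ell1 :: "ell1 set \<Rightarrow> bool" where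
  "open_ell1 S = (\<forall>x\<in>S. \<forall>\<^sub>F (x', y) in uniformity. x' = x \<longrightarrow> y \<in> S)"

instance
proof
  fix a b :: ell1 and r :: real
  show "(norm a = 0) = (a = 0)"
    by transfer (auto simp: suminf_eq_zero_iff fun_eq_iff)
  show "norm (a + b) \<le> norm a + norm b"
  proof (transfer, goal_cases)
    case (1 a b)
    have "(\<Sum>n. \<bar>a n + b n\<bar>) \<le> (\<Sum>n. \<bar>a n\<bar> + \<bar>b n\<bar>)"
      using 1 by (intro suminf_le summable_add abs_triangle_ineq abs_summable_add)
    also have "\<dots> = (\<Sum>n. \<bar>a n\<bar>) + (\<Sum>n. \<bar>b n\<bar>)"
      using 1 by (intro suminf_add[symmetric]) auto
    finally show ?case .
  qed
  show "norm (r *\<^sub>R a) = \<bar>r\<bar> * norm a"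
    by transfer (simp add: abs_mult suminf_mult)
qed (simp_all add: minus_ell1_def dist_ell1_def sgn_ell1_def uniformity_ell1_def open_ell1_def,
    (transfer, auto simp: algebra_simps)+)

end

text \<open>Isomorphic means linearly homeomorphic.\<close>

definition contains_ell1 :: "'a::banach itself \<Rightarrow> bool" where
  "contains_ell1 (_ :: 'a itself) \<longleftrightarrow>
     (\<exists>S :: 'a set. subspace S \<and> closed S \<and>
        (\<exists>(f :: ell1 \<Rightarrow> 'a) g. linear f \<and> homeomorphism UNIV S f g))"

end

theory Submission
  imports Defs
begin

text \<open>
  Bounded functionals on the projective tensor product are bounded bilinear forms \<open>A\<close> on the factors.
  If \<open>z\<close> and \<open>w\<close> are weakly null, then \<open>A (z n) (w n)\<close> tends to zero: the operator of \<open>A\<close> into a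
  dual makes one sequence a weakly null sequence of functionals on the space of the other one, which
  the Dunford-Pettis property handles, or, when it is compact, makes it norm null
  (\<open>bilinear_form_tendsto_0\<close>). For weakly Cauchy \<open>x\<close> and \<open>y\<close> this controls the second differences of
  the double sequence \<open>A (x m) (y n)\<close>, whose rows and columns converge, so that its diagonal is
  Cauchy. This is the first claim; passing to subsequences gives the second one.

  For the third claim, Rosenthal's theorem makes the unit balls of the factors weakly precompact
  (\<open>weakly_precompact_unit_ball_if_no_ell1\<close>). Its proof extracts, by an infinitary Ramsey theorem,
  from a sequence without weakly Cauchy subsequences a subsequence on which the functionals in the
  dual ball take large and small values in all patterns; such a subsequence spans a copy of
  \<open>\<ell>\<^sub>1\<close>. By the second claim, the set \<open>W\<close> of tensors of vectors in the unit balls is weakly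
  precompact, and it determines the norms of functionals on the tensor product.

  It remains to see that a Banach space with such a set \<open>W\<close> contains no copy of \<open>\<ell>\<^sub>1\<close>
  (\<open>not_contains_ell1_if_norming_weakly_precompact\<close>). Otherwise there are uniformly bounded functionals
  \<open>f i\<close> whose values on the unit vectors of \<open>\<ell>\<^sub>1\<close> are the binary digits of \<open>i\<close>, written as signs. Let
  \<open>\<phi> n z\<close> be the mean over \<open>i\<close> of \<open>f i z\<close> times the \<open>n\<close>-th sign of \<open>i\<close>, in other words the \<open>n\<close>-th
  Rademacher coefficient of \<open>f i z\<close>. It tends to zero for each \<open>z\<close>, by Bessel's inequality, but its
  norm does not, being witnessed by the unit vectors. So there are \<open>w n\<close> in \<open>W\<close> with \<open>\<phi> n (w n)\<close>
  bounded away from zero. Subtracting from late terms of a weakly Cauchy subsequence suitable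
  earlier ones yields a weakly null sequence on which the means of \<open>\<bar>f i\<bar>\<close> stay large, against a form
  of the dominated convergence theorem (\<open>mean_small_on_weakly_null\<close>).
\<close>

section \<open>Extension of functionals and the uniform boundedness principle\<close>

text \<open>
  The Hahn-Banach theorem in the form in which it is applied below. The functional is dominated by
  the infimal convolution of \<open>C * norm\<close> with \<open>\<phi>\<close>, and a linear functional below this convolution
  is automatically bounded by \<open>C\<close> and agrees with \<open>\<phi>\<close> along \<open>T\<close>.
\<close>

lemma dominated_functional_extension:
  fixes T :: "'c::real_vector \<Rightarrow> 'a::real_normed_vector" and \<phi> :: "'c \<Rightarrow> real"
  assumes T: "linear T" and \<phi>: "linear \<phi>" and C: "0 \<le> C"
    and dom: "\<And>a. \<phi> a \<le> C * norm (T a)"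
  obtains f :: "'a \<Rightarrow> real" where "linear f" "\<And>x. \<bar>f x\<bar> \<le> C * norm x" "\<And>a. f (T a) = \<phi> a"
proof -
  interpret T: linear T by (rule T)
  interpret \<phi>: linear \<phi> by (rule \<phi>)
  define p where "p v = (INF a. C * norm (v - T a) + \<phi> a)" for v
  have low: "- C * norm v \<le> C * norm (v - T a) + \<phi> a" for v a
  proof -
    have "norm (T a) \<le> norm v + norm (v - T a)"
      by (metis add_diff_cancel_left' diff_add_cancel norm_minus_commute norm_triangle_sub)
    then have "C * norm (T a) \<le> C * norm v + C * norm (v - T a)"
      using C by (metis distrib_left mult_left_mono)
    then show ?thesis using dom[of "- a"] by (simp add: T.neg \<phi>.neg)
  qed
  have bdd: "bdd_below (range (\<lambda>a. C * norm (v - T a) + \<phi> a))" for v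
    by (rule bdd_belowI2[OF low])
  have le: "p v \<le> C * norm (v - T a) + \<phi> a" for v a
    unfolding p_def by (intro cINF_lower bdd) auto
  have ge: "c \<le> p v" if "\<And>a. c \<le> C * norm (v - T a) + \<phi> a" for c v
    unfolding p_def using that by (intro cINF_greatest) auto
  have "p (v + w) \<le> p v + p w" for v w
  proof -
    have "p (v + w) - p w \<le> p v"
    proof (rule ge)
      fix a
      have "p (v + w) - (C * norm (v - T a) + \<phi> a) \<le> p w"
      proof (rule ge)
        fix b
        have "p (v + w) \<le> C * norm (v + w - T (a + b)) + \<phi> (a + b)" by (rule le)
        also have "v + w - T (a + b) = (v - T a) + (w - T b)" by (simp add: T.add)
        also have "C * norm \<dots> \<le> C * (norm (v - T a) + norm (w - T b))"
          using C by (intro mult_left_mono norm_triangle_ineq)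
        finally show "p (v + w) - (C * norm (v - T a) + \<phi> a) \<le> C * norm (w - T b) + \<phi> b"
          by (simp add: \<phi>.add distrib_left)
      qed
      then show "p (v + w) - p w \<le> C * norm (v - T a) + \<phi> a" by simp
    qed
    then show ?thesis by simp
  qed
  moreover have "p (r *\<^sub>R v) \<le> r * p v" if r: "r > 0" for r v
  proof -
    have "p (r *\<^sub>R v) / r \<le> p v"
    proof (rule ge)
      fix a
      have "p (r *\<^sub>R v) \<le> C * norm (r *\<^sub>R v - T (r *\<^sub>R a)) + \<phi> (r *\<^sub>R a)" by (rule le)
      also have "r *\<^sub>R v - T (r *\<^sub>R a) = r *\<^sub>R (v - T a)" by (simp add: T.scaleR algebra_simps)
      also have "norm \<dots> = r * norm (v - T a)" using r by simp
      finally show "p (r *\<^sub>R v) / r \<le> C * norm (v - T a) + \<phi> a"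
        using r by (simp add: \<phi>.scaleR field_simps)
    qed
    then show ?thesis using r by (simp add: field_simps)
  qed
  ultimately have "sublinear p" by (simp add: sublinear_def)
  then obtain f where f: "linear f" "\<And>y. f y \<le> p y"
    using sublinear_dominates_linear by blast
  interpret f: linear f by (rule f(1))
  have fle: "f x \<le> C * norm x" for x
    using f(2)[of x] le[of x 0] by (simp add: T.zero \<phi>.zero)
  have fT: "f (T a) \<le> \<phi> a" for a using f(2)[of "T a"] le[of "T a" a] by simp
  show thesis
  proof
    show "linear f" by (rule f(1))
    show "\<bar>f x\<bar> \<le> C * norm x" for x using fle[of x] fle[of "- x"] by (simp add: f.neg)
    show "f (T a) = \<phi> a" for a
      using fT[of a] fT[of "- a"] by (simp add: f.neg T.neg \<phi>.neg)
  qed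
qed

lemma norming_functional:
  fixes x :: "'a::real_normed_vector"
  obtains f :: "'a \<Rightarrow>\<^sub>L real" where "norm f \<le> 1" "blinfun_apply f x = norm x"
proof -
  have "linear (\<lambda>t. t *\<^sub>R x)" "linear (\<lambda>t::real. t * norm x)"
    by (auto simp: linear_iff algebra_simps)
  then obtain f :: "'a \<Rightarrow> real" where f: "linear f" "\<And>y. \<bar>f y\<bar> \<le> 1 * norm y"
      "\<And>t. f (t *\<^sub>R x) = t * norm x"
    by (rule dominated_functional_extension[of _ _ 1]) (auto simp: mult_right_mono)
  have bl: "bounded_linear f"
    using f(1,2) by (auto simp: bounded_linear_def bounded_linear_axioms_def intro!: exI[of _ 1])
  show thesis
  proof
    show "norm (Blinfun f) \<le> 1"
      using f(2) by (intro norm_blinfun_bound) (auto simp: bounded_linear_Blinfun_apply bl)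
    show "blinfun_apply (Blinfun f) x = norm x"
      using f(3)[of 1] by (simp add: bounded_linear_Blinfun_apply bl)
  qed
qed

text \<open>
  Banach-Steinhaus on the dual, which is complete: by the Baire category theorem one of the closed
  sets of functionals that are bounded by \<open>k\<close> along the sequence contains a ball.
\<close>

lemma weakly_bounded_imp_bounded:
  fixes x :: "nat \<Rightarrow> 'a::real_normed_vector"
  assumes bd: "\<And>f :: 'a \<Rightarrow>\<^sub>L real. bounded (range (\<lambda>n. blinfun_apply f (x n)))"
  shows "\<exists>R. \<forall>n. norm (x n) \<le> R"
proof -
  define E where "E k = {f :: 'a \<Rightarrow>\<^sub>L real. \<forall>n. \<bar>blinfun_apply f (x n)\<bar> \<le> real k}" for k
  have cl: "closed (E k)" for k
    unfolding E_def by (intro closed_Collect_all closed_Collect_le continuous_intros)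
  have un: "\<Union>(range E) = UNIV"
  proof -
    have "\<exists>k. f \<in> E k" for f
    proof -
      obtain B where B: "\<And>n. \<bar>blinfun_apply f (x n)\<bar> \<le> B"
        using bd[of f] by (auto simp: bounded_iff)
      obtain k where "B \<le> real k" using real_arch_simple by blast
      then have "\<bar>blinfun_apply f (x n)\<bar> \<le> real k" for n using B[of n] by linarith
      then show ?thesis by (auto simp: E_def)
    qed
    then show ?thesis by blast
  qed
  have "\<exists>k. interior (E k) \<noteq> {}"
  proof (rule ccontr)
    assume "\<not> ?thesis"
    then have empty: "interior (E k) = {}" for k by blast
    have "Met_TC.mtopology interior_of \<Union>(range E) = {}"
    proof (intro Met_TC.metric_Baire_category_alt conjI)
      show "Met_TC.mcomplete TYPE('a \<Rightarrow>\<^sub>L real)" by (simp add: complete_UNIV)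
      show "countable (range E)" by simp
    next
      fix T assume "T \<in> range E"
      then obtain k where "T = E k" by blast
      then show "closedin Met_TC.mtopology T" "Met_TC.mtopology interior_of T = {}"
        using cl[of k] empty by simp_all
    qed
    then show False by (simp add: un del: Union_UNIV)
  qed
  then obtain k f0 where "f0 \<in> interior (E k)" by blast
  then obtain e where e: "e > 0" "cball f0 e \<subseteq> E k"
    unfolding mem_interior_cball by blast
  have "norm (x n) \<le> 2 * real k / e" for n
  proof -
    obtain g :: "'a \<Rightarrow>\<^sub>L real" where g: "norm g \<le> 1" "blinfun_apply g (x n) = norm (x n)"
      by (rule norming_functional)
    have "f0 + e *\<^sub>R g \<in> cball f0 e" "f0 \<in> cball f0 e"
      using e(1) g(1) by (simp_all add: dist_norm mult_left_le)
    with e(2) have "f0 + e *\<^sub>R g \<in> E k" "f0 \<in> E k" by blast+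
    then have "\<bar>blinfun_apply f0 (x n) + e * norm (x n)\<bar> \<le> real k" "\<bar>blinfun_apply f0 (x n)\<bar> \<le> real k"
      unfolding E_def g(2)[symmetric] by (simp_all add: blinfun.add_left blinfun.scaleR_left)
    then have "e * norm (x n) \<le> 2 * real k" by linarith
    then show ?thesis using e(1) by (simp add: field_simps)
  qed
  then show ?thesis by blast
qed

section \<open>Weakly Cauchy and weakly null sequences\<close>

lemma weakly_null_bounded:
  "weakly_null x \<Longrightarrow> \<exists>R. \<forall>n. norm (x n) \<le> R"
  by (intro weakly_bounded_imp_bounded convergent_imp_bounded) (auto simp: weakly_null_def)

lemma weakly_null_image:
  fixes T :: "'a::real_normed_vector \<Rightarrow>\<^sub>L 'b::real_normed_vector"
  assumes "weakly_null x"
  shows "weakly_null (\<lambda>n. blinfun_apply T (x n))"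
  unfolding weakly_null_def
proof
  fix f :: "'b \<Rightarrow>\<^sub>L real"
  show "(\<lambda>n. blinfun_apply f (blinfun_apply T (x n))) \<longlonglongrightarrow> 0"
    using assms[unfolded weakly_null_def, rule_format, of "f o\<^sub>L T"] by simp
qed

lemma weakly_Cauchy_subseq_diff:
  fixes x :: "nat \<Rightarrow> 'a::real_normed_vector"
  assumes x: "weakly_Cauchy x" and p: "\<And>k. k \<le> p k" and q: "\<And>k. k \<le> q k"
  shows "weakly_null (\<lambda>k. x (p k) - x (q k))"
  unfolding weakly_null_def
proof
  fix f :: "'a \<Rightarrow>\<^sub>L real"
  obtain l where l: "(\<lambda>n. blinfun_apply f (x n)) \<longlonglongrightarrow> l"
    using x unfolding weakly_Cauchy_def Cauchy_convergent_iff convergent_def by blast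
  have "filterlim p at_top sequentially" "filterlim q at_top sequentially"
    using p q by (auto intro: filterlim_at_top_mono[OF filterlim_ident always_eventually])
  from tendsto_diff[OF filterlim_compose[OF l this(1)] filterlim_compose[OF l this(2)]]
  show "(\<lambda>k. blinfun_apply f (x (p k) - x (q k))) \<longlonglongrightarrow> 0"
    by (simp add: blinfun.diff_right)
qed

text \<open>Norm cluster points exist by compactness, and they are weak limits, hence zero.\<close>

lemma weakly_null_in_compact_tendsto_0:
  fixes x :: "nat \<Rightarrow> 'a::real_normed_vector"
  assumes x: "weakly_null x" and K: "compact K" "\<And>n. x n \<in> K"
  shows "x \<longlonglongrightarrow> 0"
proof (rule ccontr)
  assume "\<not> ?thesis"
  then obtain e where e: "e > 0" "\<exists>\<^sub>F n in sequentially. e \<le> norm (x n)"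
    unfolding tendsto_iff by (auto simp: not_eventually not_less)
  from e(2) have "infinite {n. e \<le> norm (x n)}"
    unfolding cofinite_eq_sequentially[symmetric] frequently_cofinite .
  then obtain r :: "nat \<Rightarrow> nat" where r: "strict_mono r" "\<And>k. e \<le> norm (x (r k))"
    using infinite_enumerate[of "{n. e \<le> norm (x n)}"] by auto
  obtain l s where s: "strict_mono s" "((x \<circ> r) \<circ> s) \<longlonglongrightarrow> l"
    using seq_compactE[OF compact_imp_seq_compact[OF K(1)], of "x \<circ> r"] K(2)
    by (metis comp_apply)
  have "norm l \<ge> e"
    using tendsto_norm[OF s(2)] r(2) by (intro LIMSEQ_le_const) auto
  obtain f :: "'a \<Rightarrow>\<^sub>L real" where f: "blinfun_apply f l = norm l"
    by (rule norming_functional)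
  have "(\<lambda>n. blinfun_apply f (((x \<circ> r) \<circ> s) n)) \<longlonglongrightarrow> blinfun_apply f l"
    using s(2) by (intro tendsto_intros) (auto simp: o_def)
  moreover have "(\<lambda>n. blinfun_apply f (((x \<circ> r) \<circ> s) n)) \<longlonglongrightarrow> 0"
    using LIMSEQ_subseq_LIMSEQ[OF x[unfolded weakly_null_def, rule_format, of f], of "r \<circ> s"]
      r(1) s(1) by (simp add: o_def strict_mono_def)
  ultimately have "norm l = 0" using f LIMSEQ_unique by metis
  with \<open>norm l \<ge> e\<close> e(1) show False by simp
qed

section \<open>Functionals on the projective tensor product\<close>

lemma norm_elem_tensor_le: "norm (elem_tensor x y) \<le> norm x * norm y"
  using projective_norm_le[of "[(x, y)]"] by (simp add: norm_tensor_def elem_tensor.abs_eq)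

lemma bounded_bilinear_ptensor:
  "bounded_bilinear ((\<otimes>\<^sub>\<pi>) :: 'a::real_normed_vector \<Rightarrow> 'b::real_normed_vector \<Rightarrow> _)"
proof -
  interpret C: linear "to_completion :: ('a, 'b) tensor \<Rightarrow> _" by (rule linear_to_completion)
  have l: "elem_tensor (x + x') y = elem_tensor x y + elem_tensor x' y"
    and r: "elem_tensor x (y + y') = elem_tensor x y + elem_tensor x y'"
    and sl: "elem_tensor (c *\<^sub>R x) y = c *\<^sub>R elem_tensor x y"
    and sr: "elem_tensor x (c *\<^sub>R y) = c *\<^sub>R elem_tensor x y"
    for x x' :: 'a and y y' :: 'b and c
    by (transfer, simp add: tensor_eq_def scale_first_def bilinear_ladd bilinear_radd
        bilinear_lmul bilinear_rmul)+
  show ?thesis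
  proof
    show "\<exists>K. \<forall>x y. norm (x \<otimes>\<^sub>\<pi> y) \<le> norm (x :: 'a) * norm (y :: 'b) * K"
      by (intro exI[of _ 1]) (simp add: ptensor_def norm_elem_tensor_le)
  qed (simp_all add: ptensor_def l r sl sr C.add C.scaleR)
qed

lemma norm_ptensor_le: "norm (x \<otimes>\<^sub>\<pi> y) \<le> norm x * norm y"
  by (simp add: ptensor_def norm_elem_tensor_le)

lemma bounded_bilinear_functional_ptensor:
  fixes \<phi> :: "('a::real_normed_vector, 'b::real_normed_vector) projective_tensor \<Rightarrow> real"
  assumes "bounded_linear \<phi>"
  shows "bounded_bilinear (\<lambda>x y. \<phi> (x \<otimes>\<^sub>\<pi> y))"
proof -
  interpret \<phi>: bounded_linear \<phi> by (rule assms)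
  interpret P: bounded_bilinear "(\<otimes>\<^sub>\<pi>) :: 'a \<Rightarrow> 'b \<Rightarrow> _" by (rule bounded_bilinear_ptensor)
  obtain K where K: "K \<ge> 0" "\<And>z. norm (\<phi> z) \<le> norm z * K" using \<phi>.nonneg_bounded by blast
  show ?thesis
  proof
    have "norm (\<phi> (x \<otimes>\<^sub>\<pi> y)) \<le> norm x * norm y * K" for x y
      using K(2) mult_right_mono[OF norm_ptensor_le K(1)] order_trans by blast
    then show "\<exists>K. \<forall>x y. norm (\<phi> (x \<otimes>\<^sub>\<pi> y)) \<le> norm x * norm y * K" by blast
  qed (simp_all add: P.add_left P.add_right P.scaleR_left P.scaleR_right \<phi>.add \<phi>.scaleR)
qed

lemma to_completion_abs_tensor:
  fixes u :: "('a::real_normed_vector \<times> 'b::real_normed_vector) list"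
  shows "to_completion (abs_tensor u) = (\<Sum>(x, y)\<leftarrow>u. x \<otimes>\<^sub>\<pi> y)"
proof (induction u)
  interpret C: linear "to_completion :: ('a, 'b) tensor \<Rightarrow> _" by (rule linear_to_completion)
  case Nil
  show ?case using C.zero by (simp add: zero_tensor_def)
next
  interpret C: linear "to_completion :: ('a, 'b) tensor \<Rightarrow> _" by (rule linear_to_completion)
  case (Cons p u)
  have "abs_tensor (p # u) = elem_tensor (fst p) (snd p) + abs_tensor u"
    using abs_tensor_append[of "[p]" u] by (simp add: elem_tensor.abs_eq)
  then show ?case using Cons by (simp add: C.add ptensor_def split_beta)
qed

text \<open>
  The unit ball of the projective tensor product is the closed convex hull of the tensors of
  vectors in the unit balls of the factors. Dually, elementary tensors determine the norm of a
  functional: its bound on them passes to finite sums, to the infimum over all representations, and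
  to limits.
\<close>

lemma functional_le_if_le_on_elementary_tensors:
  fixes \<phi> :: "('a::real_normed_vector, 'b::real_normed_vector) projective_tensor \<Rightarrow> real"
  assumes \<phi>: "bounded_linear \<phi>"
    and M: "\<And>x y. \<bar>\<phi> (x \<otimes>\<^sub>\<pi> y)\<bar> \<le> M * (norm x * norm y)"
  shows "\<bar>\<phi> z\<bar> \<le> M * norm z"
proof -
  interpret \<phi>: bounded_linear \<phi> by (rule \<phi>)
  have M0: "M \<ge> 0" if nz: "\<exists>x::'a. x \<noteq> 0" "\<exists>y::'b. y \<noteq> 0"
  proof -
    obtain x :: 'a where "x \<noteq> 0" using nz(1) ..
    obtain y :: 'b where "y \<noteq> 0" using nz(2) ..
    with \<open>x \<noteq> 0\<close> have "0 < norm x * norm y" by simp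
    moreover have "0 \<le> M * (norm x * norm y)" using M[of x y] by linarith
    ultimately show ?thesis by (simp add: zero_le_mult_iff)
  qed
  have list: "\<bar>\<phi> (to_completion (abs_tensor u))\<bar> \<le> M * rep_cost u"
    for u :: "('a \<times> 'b) list"
  proof -
    have "\<phi> (to_completion (abs_tensor u)) = form_sum (\<lambda>x y. \<phi> (x \<otimes>\<^sub>\<pi> y)) u"
      unfolding to_completion_abs_tensor
      by (induction u) (auto simp: \<phi>.zero \<phi>.add)
    then show ?thesis using bounded_form_sum_le[OF M, of u] by simp
  qed
  have alg: "\<bar>\<phi> (to_completion t)\<bar> \<le> M * norm t" for t :: "('a, 'b) tensor"
  proof (cases "M > 0")
    case True
    have "\<bar>\<phi> (to_completion t)\<bar> / M \<le> projective_norm t"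
      using list True by (intro projective_norm_ge) (simp add: field_simps)
    then show ?thesis using True by (simp add: norm_tensor_def field_simps)
  next
    case False
    obtain u where u: "t = abs_tensor u" by (metis Quotient3_abs_rep Quotient3_tensor)
    show ?thesis
    proof (cases "(\<exists>x::'a. x \<noteq> 0) \<and> (\<exists>y::'b. y \<noteq> 0)")
      case True
      with M0 False have "M = 0" by force
      then show ?thesis using list[of u] u by simp
    next
      case False
      then have "rep_cost v = 0" for v :: "('a \<times> 'b) list"
        by (induction v) auto
      then have "norm t = 0" "\<phi> (to_completion t) = 0"
        using list[of u] u projective_norm_le[of u] projective_norm_nonneg[of t]
        by (auto simp: norm_tensor_def)
      then show ?thesis by simp
    qed
  qed
  obtain X where X: "Cauchy X" "z = abs_cauchy_completion X" by (rule cauchy_completion_cases)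
  have lim: "(\<lambda>n. to_completion (X n)) \<longlonglongrightarrow> z" using to_completion_tendsto X by blast
  have "(\<lambda>n. \<bar>\<phi> (to_completion (X n))\<bar>) \<longlonglongrightarrow> \<bar>\<phi> z\<bar>"
    by (intro tendsto_rabs \<phi>.tendsto lim)
  moreover have "(\<lambda>n. M * norm (to_completion (X n))) \<longlonglongrightarrow> M * norm z"
    by (intro tendsto_intros lim)
  ultimately show ?thesis
    using alg by (intro LIMSEQ_le) auto
qed

section \<open>Tensor products of weakly Cauchy sequences\<close>

text \<open>
  A bounded bilinear form is an operator into the dual. It maps one weakly null sequence to a weakly
  null sequence of functionals, to be tested on the other one by the Dunford-Pettis property, or,
  when this operator is compact, to a norm null sequence.
\<close>

lemma bilinear_form_tendsto_0:
  fixes A :: "'a::banach \<Rightarrow> 'b::banach \<Rightarrow> real"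
  assumes A: "bounded_bilinear A"
    and cond: "dunford_pettis TYPE('a) \<or> dunford_pettis TYPE('b) \<or>
      (UNIV :: ('a \<Rightarrow>\<^sub>L ('b \<Rightarrow>\<^sub>L real)) set) = compact_operators"
    and z: "weakly_null z" and w: "weakly_null w"
  shows "(\<lambda>n. A (z n) (w n)) \<longlonglongrightarrow> 0"
proof -
  have op: "\<exists>T :: 'c \<Rightarrow>\<^sub>L ('d \<Rightarrow>\<^sub>L real). \<forall>x y. blinfun_apply (blinfun_apply T x) y = D x y"
    if D: "bounded_bilinear D" for D :: "'c::banach \<Rightarrow> 'd::banach \<Rightarrow> real"
  proof -
    interpret D: bounded_bilinear D by (rule D)
    obtain K where K: "K \<ge> 0" "\<And>x y. norm (D x y) \<le> norm x * norm y * K"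
      using D.nonneg_bounded by blast
    have ap: "blinfun_apply (Blinfun (D x)) = D x" for x
      by (intro bounded_linear_Blinfun_apply D.bounded_linear_right)
    have "bounded_linear (\<lambda>x. Blinfun (D x))"
    proof
      show "Blinfun (D (x + y)) = Blinfun (D x) + Blinfun (D y)" for x y
        by (intro blinfun_eqI) (simp add: ap blinfun.add_left D.add_left)
      show "Blinfun (D (r *\<^sub>R x)) = r *\<^sub>R Blinfun (D x)" for r x
        by (intro blinfun_eqI) (simp add: ap blinfun.scaleR_left D.scaleR_left)
      show "\<exists>K. \<forall>x. norm (Blinfun (D x)) \<le> norm x * K"
        using K by (intro exI[of _ K] allI norm_blinfun_bound) (auto simp: ap mult_ac)
    qed
    then show ?thesis
      by (intro exI[of _ "Blinfun (\<lambda>x. Blinfun (D x))"])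
        (simp add: bounded_linear_Blinfun_apply ap)
  qed
  obtain T :: "'a \<Rightarrow>\<^sub>L ('b \<Rightarrow>\<^sub>L real)" where T: "\<And>x y. blinfun_apply (blinfun_apply T x) y = A x y"
    using op[OF A] by blast
  obtain T' :: "'b \<Rightarrow>\<^sub>L ('a \<Rightarrow>\<^sub>L real)" where T': "\<And>x y. blinfun_apply (blinfun_apply T' y) x = A x y"
    using op[OF bounded_bilinear.flip[OF A]] by blast
  note Tz = weakly_null_image[OF z, of T]
  note Tw = weakly_null_image[OF w, of T']
  consider "dunford_pettis TYPE('a)" | "dunford_pettis TYPE('b)" | "T \<in> compact_operators"
    using cond by blast
  then show ?thesis
  proof cases
    case 1
    then have "(\<lambda>n. blinfun_apply (blinfun_apply T' (w n)) (z n)) \<longlonglongrightarrow> 0"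
      using z Tw unfolding dunford_pettis_def by blast
    then show ?thesis by (simp add: T')
  next
    case 2
    then have "(\<lambda>n. blinfun_apply (blinfun_apply T (z n)) (w n)) \<longlonglongrightarrow> 0"
      using w Tz unfolding dunford_pettis_def by blast
    then show ?thesis by (simp add: T)
  next
    case 3
    obtain R where R: "\<And>n. norm (z n) \<le> R" using weakly_null_bounded[OF z] by blast
    obtain S where S: "\<And>n. norm (w n) \<le> S" using weakly_null_bounded[OF w] by blast
    define Q where "Q = max 1 R"
    have Q: "Q > 0" "\<And>n. norm (z n) \<le> Q" using R by (auto simp: Q_def le_max_iff_disj)
    have "weakly_null (\<lambda>n. blinfun_apply T ((1 / Q) *\<^sub>R z n))"
      using weakly_null_image[OF z, of "(1 / Q) *\<^sub>R T"]
      by (simp add: blinfun.scaleR_left blinfun.scaleR_right)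
    then have "(\<lambda>n. blinfun_apply T ((1 / Q) *\<^sub>R z n)) \<longlonglongrightarrow> 0"
    proof (rule weakly_null_in_compact_tendsto_0)
      show "compact (closure (blinfun_apply T ` cball 0 1))"
        using 3 by (simp add: compact_operators_def)
      show "blinfun_apply T ((1 / Q) *\<^sub>R z n) \<in> closure (blinfun_apply T ` cball 0 1)" for n
        using Q by (intro closure_subset[THEN subsetD] imageI) simp
    qed
    from tendsto_scaleR[OF tendsto_const[of Q] this]
    have "(\<lambda>n. blinfun_apply T (z n)) \<longlonglongrightarrow> 0"
      using Q(1) by (simp add: blinfun.scaleR_right)
    then have lim: "(\<lambda>n. norm (blinfun_apply T (z n)) * S) \<longlonglongrightarrow> 0"
      by (intro tendsto_mult_left_zero tendsto_norm_zero)
    show ?thesis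
    proof (rule Lim_null_comparison[OF _ lim], rule always_eventually, rule allI)
      fix n
      have "norm (A (z n) (w n)) \<le> norm (blinfun_apply T (z n)) * norm (w n)"
        using norm_blinfun[of "blinfun_apply T (z n)" "w n"] by (simp add: T)
      also have "\<dots> \<le> norm (blinfun_apply T (z n)) * S" by (intro mult_left_mono S) auto
      finally show "norm (A (z n) (w n)) \<le> norm (blinfun_apply T (z n)) * S" .
    qed
  qed
qed

text \<open>
  The second difference of the double sequence \<open>A (x m) (y n)\<close> tends to zero and its rows and columns
  converge. Fixing one large index \<open>m\<close> leaves the diagonal up to small errors and convergent terms.
\<close>

lemma bilinear_form_Cauchy:
  fixes A :: "'a::banach \<Rightarrow> 'b::banach \<Rightarrow> real"
  assumes A: "bounded_bilinear A"
    and null: "\<And>z w. weakly_null z \<Longrightarrow> weakly_null w \<Longrightarrow> (\<lambda>n. A (z n) (w n)) \<longlonglongrightarrow> 0"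
    and x: "weakly_Cauchy x" and y: "weakly_Cauchy y"
  shows "Cauchy (\<lambda>n. A (x n) (y n))"
proof (rule CauchyI)
  interpret A: bounded_bilinear A by (rule A)
  fix e :: real assume e: "e > 0"
  have "\<exists>N. \<forall>m\<ge>N. \<forall>n\<ge>N. \<bar>A (x n - x m) (y n - y m)\<bar> < e / 4"
  proof (rule ccontr)
    assume "\<not> ?thesis"
    then obtain p q where pq: "\<And>N. N \<le> p N" "\<And>N. N \<le> q N"
      "\<And>N. e / 4 \<le> \<bar>A (x (q N) - x (p N)) (y (q N) - y (p N))\<bar>"
      by (metis not_less)
    have "(\<lambda>N. A (x (q N) - x (p N)) (y (q N) - y (p N))) \<longlonglongrightarrow> 0"
      by (intro null weakly_Cauchy_subseq_diff x y pq)
    then obtain N where "\<bar>A (x (q N) - x (p N)) (y (q N) - y (p N))\<bar> < e / 4"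
      using LIMSEQ_D[of _ 0 "e / 4"] e by fastforce
    then show False using pq(3)[of N] by simp
  qed
  then obtain m where m: "\<And>n. n \<ge> m \<Longrightarrow> \<bar>A (x n - x m) (y n - y m)\<bar> < e / 4" by blast
  have "Cauchy (\<lambda>n. A (x m) (y n))"
    using y[unfolded weakly_Cauchy_def, rule_format, of "Blinfun (A (x m))"]
    by (simp add: bounded_linear_Blinfun_apply A.bounded_linear_right)
  moreover have "Cauchy (\<lambda>n. A (x n) (y m))"
    using x[unfolded weakly_Cauchy_def, rule_format, of "Blinfun (\<lambda>v. A v (y m))"]
    by (simp add: bounded_linear_Blinfun_apply A.bounded_linear_left)
  ultimately have "Cauchy (\<lambda>n. A (x m) (y n) + A (x n) (y m))" by (rule Cauchy_plus)
  then obtain N where N: "\<And>k n. k \<ge> N \<Longrightarrow> n \<ge> N \<Longrightarrow>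
      norm (A (x m) (y k) + A (x k) (y m) - (A (x m) (y n) + A (x n) (y m))) < e / 2"
    using e unfolding Cauchy_norm_diff by (meson half_gt_zero)
  have "norm (A (x k) (y k) - A (x n) (y n)) < e" if "k \<ge> max m N" "n \<ge> max m N" for k n
    using N[of k n] m[of k] m[of n] that
    by (auto simp: A.diff_left A.diff_right abs_if split: if_splits)
  then show "\<exists>M. \<forall>k\<ge>M. \<forall>n\<ge>M. norm (A (x k) (y k) - A (x n) (y n)) < e" by blast
qed

lemma weakly_Cauchy_ptensor:
  fixes x :: "nat \<Rightarrow> 'a::banach" and y :: "nat \<Rightarrow> 'b::banach"
  assumes cond: "dunford_pettis TYPE('a) \<or> dunford_pettis TYPE('b) \<or>
      (UNIV :: ('a \<Rightarrow>\<^sub>L ('b \<Rightarrow>\<^sub>L real)) set) = compact_operators"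
    and x: "weakly_Cauchy x" and y: "weakly_Cauchy y"
  shows "weakly_Cauchy (\<lambda>n. x n \<otimes>\<^sub>\<pi> y n)"
  unfolding weakly_Cauchy_def
proof
  fix F :: "('a, 'b) projective_tensor \<Rightarrow>\<^sub>L real"
  have A: "bounded_bilinear (\<lambda>x y. blinfun_apply F (x \<otimes>\<^sub>\<pi> y))"
    by (intro bounded_bilinear_functional_ptensor blinfun.bounded_linear_right)
  show "Cauchy (\<lambda>n. blinfun_apply F (x n \<otimes>\<^sub>\<pi> y n))"
    by (rule bilinear_form_Cauchy[OF A bilinear_form_tendsto_0[OF A cond] x y])
qed

lemma weakly_Cauchy_subseq: "weakly_Cauchy x \<Longrightarrow> strict_mono r \<Longrightarrow> weakly_Cauchy (x \<circ> r)"
  unfolding weakly_Cauchy_def using Cauchy_subseq_Cauchy by (auto simp: o_def)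

lemma weakly_precompact_set_ptensor:
  fixes W1 :: "'a::real_normed_vector set" and W2 :: "'b::real_normed_vector set"
  assumes Cauchy: "\<And>(x :: nat \<Rightarrow> 'a) (y :: nat \<Rightarrow> 'b).
      weakly_Cauchy x \<Longrightarrow> weakly_Cauchy y \<Longrightarrow> weakly_Cauchy (\<lambda>n. x n \<otimes>\<^sub>\<pi> y n)"
    and W: "weakly_precompact W1" "weakly_precompact W2"
  shows "weakly_precompact (set_ptensor W1 W2)"
  unfolding weakly_precompact_def
proof (intro allI impI)
  fix u :: "nat \<Rightarrow> ('a, 'b) projective_tensor" assume "range u \<subseteq> set_ptensor W1 W2"
  then have "\<forall>n. \<exists>x y. u n = x \<otimes>\<^sub>\<pi> y \<and> x \<in> W1 \<and> y \<in> W2"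
    unfolding set_ptensor_def by blast
  then obtain x y where xy: "\<And>n. u n = x n \<otimes>\<^sub>\<pi> y n" "range x \<subseteq> W1" "range y \<subseteq> W2"
    by (metis image_subsetI)
  obtain r where r: "strict_mono r" "weakly_Cauchy (x \<circ> r)"
    using W(1) xy(2) unfolding weakly_precompact_def by blast
  have "range (y \<circ> r) \<subseteq> W2" using xy(3) by auto
  then obtain s where s: "strict_mono s" "weakly_Cauchy ((y \<circ> r) \<circ> s)"
    using W(2) unfolding weakly_precompact_def by blast
  have "weakly_Cauchy (\<lambda>n. (x \<circ> r \<circ> s) n \<otimes>\<^sub>\<pi> (y \<circ> r \<circ> s) n)"
    by (intro Cauchy weakly_Cauchy_subseq r s)
  then have "weakly_Cauchy (u \<circ> (r \<circ> s))" by (simp add: o_def xy(1))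
  then show "\<exists>r. strict_mono r \<and> weakly_Cauchy (u \<circ> r)"
    using strict_mono_o[OF r(1) s(1)] by blast
qed

section \<open>A Ramsey theorem for open families of infinite sets\<close>

definition beyond :: "nat set \<Rightarrow> nat set \<Rightarrow> nat set" where
  "beyond s A = {n \<in> A. \<forall>k\<in>s. k < n}"

lemma beyond_empty [simp]: "beyond {} A = A"
  by (simp add: beyond_def)

lemma beyond_subset: "beyond s A \<subseteq> A"
  by (auto simp: beyond_def)

lemma finite_diff_beyond:
  assumes "finite s"
  shows "finite (A - beyond s A)"
proof (rule finite_subset)
  show "A - beyond s A \<subseteq> (\<Union>k\<in>s. {..k})" by (auto simp: beyond_def not_less)
  show "finite (\<Union>k\<in>s. {..k})" using assms by simp
qed

lemma infinite_beyond:
  assumes "finite s" "infinite A"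
  shows "infinite (beyond s A)"
  using finite_diff_beyond[OF assms(1), of A] assms(2) Diff_infinite_finite by blast

text \<open>
  Diagonalization: each property of infinite sets that is hereditary and can be reached by
  shrinking may be imposed for all finite sets \<open>s\<close> at once, on the elements beyond \<open>s\<close>. One adds one
  element after another and shrinks the reservoir of the later elements each time.
\<close>

lemma fusion:
  fixes P :: "nat set \<Rightarrow> nat set \<Rightarrow> bool"
  assumes M: "infinite M"
    and her: "\<And>s A B. P s A \<Longrightarrow> B \<subseteq> A \<Longrightarrow> P s B"
    and dense: "\<And>s A. finite s \<Longrightarrow> s \<subseteq> M \<Longrightarrow> A \<subseteq> M \<Longrightarrow> infinite A \<Longrightarrow>
      \<exists>B\<subseteq>A. infinite B \<and> P s B"
  obtains L where "L \<subseteq> M" "infinite L" "\<And>s. finite s \<Longrightarrow> s \<subseteq> L \<Longrightarrow> P s (beyond s L)"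
proof -
  have shrink: "\<exists>B\<subseteq>A. infinite B \<and> (\<forall>t\<in>T. P t B)"
    if "finite T" "\<And>t. t \<in> T \<Longrightarrow> finite t \<and> t \<subseteq> M" "A \<subseteq> M" "infinite A" for T A
    using that
  proof (induction T rule: finite_induct)
    case empty then show ?case by blast
  next
    case (insert t T)
    then obtain B where B: "B \<subseteq> A" "infinite B" "\<And>t. t \<in> T \<Longrightarrow> P t B"
      by (metis insert_iff)
    then obtain C where "C \<subseteq> B" "infinite C" "P t C"
      using dense[of t B] insert.prems(1)[of t] insert.prems(2) by blast
    then show ?case using B her by (metis insert_iff order_trans)
  qed
  define inv where "inv = (\<lambda>(s, A). finite s \<and> s \<subseteq> M \<and> A \<subseteq> M \<and> infinite A \<and>
    (\<forall>a\<in>s. \<forall>b\<in>A. a < b) \<and> (\<forall>t\<subseteq>s. P t A))"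
  define step where "step = (\<lambda>(s, A) (s', A'). \<exists>n\<in>A. s' = insert n s \<and> A' \<subseteq> (A :: nat set))"
  have "\<exists>q. \<forall>k. (inv (q k) \<and> (k = 0 \<longrightarrow> fst (q k) = {})) \<and> step (q k) (q (Suc k))"
  proof (rule dependent_nat_choice)
    obtain B where "B \<subseteq> M" "infinite B" "P {} B" using dense[of "{}" M] M by blast
    then show "\<exists>q. inv q \<and> (0 = (0::nat) \<longrightarrow> fst q = {})"
      by (intro exI[of _ "({}, B)"]) (auto simp: inv_def)
  next
    fix q and k :: nat assume "inv q \<and> (k = 0 \<longrightarrow> fst q = {})"
    moreover obtain s A where q: "q = (s, A)" by force
    ultimately have inv: "finite s" "s \<subseteq> M" "A \<subseteq> M" "infinite A" "\<And>a b. a \<in> s \<Longrightarrow> b \<in> A \<Longrightarrow> a < b"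
      by (auto simp: inv_def)
    obtain n where n: "n \<in> A" using inv(4) by fastforce
    have "infinite (beyond {n} A)" using inv(4) by (intro infinite_beyond) auto
    moreover have "finite t \<and> t \<subseteq> M" if "t \<in> Pow (insert n s)" for t
      using that inv n finite_subset[of t "insert n s"] by auto
    moreover have "beyond {n} A \<subseteq> M" using inv(3) by (auto simp: beyond_def)
    moreover have "finite (Pow (insert n s))" using inv(1) by simp
    ultimately obtain B where B: "B \<subseteq> beyond {n} A" "infinite B" "\<forall>t\<in>Pow (insert n s). P t B"
      using shrink[of "Pow (insert n s)" "beyond {n} A"] by blast
    have "inv (insert n s, B)"
      using B inv n unfolding inv_def by (auto simp: beyond_def subset_iff)
    moreover have "step q (insert n s, B)"
      using B(1) n beyond_subset unfolding step_def q by auto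
    ultimately show "\<exists>q'. (inv q' \<and> (Suc k = 0 \<longrightarrow> fst q' = {})) \<and> step q q'" by blast
  qed
  then obtain q where q: "\<And>k. inv (q k)" "fst (q 0) = {}" "\<And>k. step (q k) (q (Suc k))" by blast
  define S where "S k = fst (q k)" for k
  define A where "A k = snd (q k)" for k
  have inv: "finite (S k)" "S k \<subseteq> M" "\<And>a b. a \<in> S k \<Longrightarrow> b \<in> A k \<Longrightarrow> a < b"
    "\<And>t. t \<subseteq> S k \<Longrightarrow> P t (A k)" for k
    using q(1)[of k] by (auto simp: inv_def S_def A_def split_beta)
  have S0: "S 0 = {}" using q(2) by (simp add: S_def)
  have st: "\<exists>n\<in>A k. S (Suc k) = insert n (S k) \<and> A (Suc k) \<subseteq> A k" for k
    using q(3)[of k] by (auto simp: step_def S_def A_def split_beta)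
  have Smono: "S k \<subseteq> S j" if "k \<le> j" for k j
  proof (rule lift_Suc_mono_le[OF _ that])
    show "S i \<subseteq> S (Suc i)" for i using st[of i] by blast
  qed
  have reservoir: "S j \<subseteq> S k \<union> A k \<and> A j \<subseteq> A k" if "k \<le> j" for k j
    using that
  proof (induction j rule: dec_induct)
    case base then show ?case by blast
  next
    case (step j)
    obtain n where "n \<in> A j" "S (Suc j) = insert n (S j)" "A (Suc j) \<subseteq> A j"
      using st by blast
    then show ?case using step.IH by auto
  qed
  have cardS: "card (S k) = k" for k
  proof (induction k)
    case 0 then show ?case by (simp add: S0)
  next
    case (Suc k)
    obtain n where n: "n \<in> A k" "S (Suc k) = insert n (S k)" using st by blast
    then have "n \<notin> S k" using inv(3)[of n k n] by auto
    then show ?case using n(2) inv(1) Suc by simp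
  qed
  define L where "L = (\<Union>k. S k)"
  show thesis
  proof
    show "L \<subseteq> M" using inv(2) by (auto simp: L_def)
    show inf: "infinite L"
    proof
      assume "finite L"
      then have "card (S (Suc (card L))) \<le> card L" by (intro card_mono) (auto simp: L_def)
      then show False by (simp add: cardS)
    qed
    fix t assume t: "finite t" "t \<subseteq> L"
    have "\<exists>k. t \<subseteq> S k"
      using t
    proof (induction t rule: finite_induct)
      case (insert x t)
      then obtain k j where "t \<subseteq> S k" "x \<in> S j" by (auto simp: L_def)
      then have "insert x t \<subseteq> S (max k j)" using Smono[of k "max k j"] Smono[of j "max k j"] by auto
      then show ?case by blast
    qed auto
    define k where "k = (LEAST k. t \<subseteq> S k)"
    have tk: "t \<subseteq> S k" unfolding k_def using \<open>\<exists>k. t \<subseteq> S k\<close> by (rule LeastI_ex)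
    have "beyond t L \<subseteq> A k"
    proof
      fix m assume m: "m \<in> beyond t L"
      then obtain j where j: "m \<in> S j" by (auto simp: L_def beyond_def)
      have "m \<notin> S k"
      proof
        assume mk: "m \<in> S k"
        then obtain i where i: "k = Suc i" using S0 by (cases k) auto
        then have "\<not> t \<subseteq> S i" using not_less_Least[of i "\<lambda>k. t \<subseteq> S k"] by (simp add: k_def)
        moreover obtain n where n: "n \<in> A i" "S k = insert n (S i)" using st[of i] i by blast
        ultimately have "n \<in> t" using tk by auto
        then have "n < m" using m by (simp add: beyond_def)
        moreover have "m \<in> S i" using mk n(2) \<open>n < m\<close> by auto
        ultimately show False using inv(3)[of m i n] n(1) by simp
      qed
      moreover have "m \<in> S (max j k)" using j Smono[of j "max j k"] by auto
      ultimately show "m \<in> A k" using reservoir[of k "max j k"] by auto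
    qed
    then show "P t (beyond t L)" using inv(4)[OF tk] her by blast
  qed
qed

text \<open>
  The argument of Galvin and Nash-Williams. A set \<open>A\<close> accepts \<open>s\<close> if every infinite continuation of
  \<open>s\<close> inside \<open>A\<close> has an initial segment in \<open>F\<close>. After one diagonalization every finite set is either
  accepted or rejected for good. If the empty set is rejected then so are, after a second one, all
  finite sets, because a rejected set has only finitely many accepted one-point extensions; and a
  rejected set is not in \<open>F\<close>.
\<close>

lemma galvin_lemma:
  fixes F :: "nat set \<Rightarrow> bool"
  assumes M: "infinite M"
  obtains L where "L \<subseteq> M" "infinite L"
    "(\<forall>s\<subseteq>L. finite s \<longrightarrow> \<not> F s) \<or> (\<forall>N\<subseteq>L. infinite N \<longrightarrow> (\<exists>j. F (N \<inter> {..<j})))"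
proof -
  define acc where "acc s A \<longleftrightarrow> (\<forall>N\<subseteq>A. infinite N \<longrightarrow> (\<forall>k\<in>s. \<forall>n\<in>N. k < n) \<longrightarrow>
    (\<exists>j. F ((s \<union> N) \<inter> {..<j})))" for s A
  have acc_mono: "acc s B" if "acc s A" "B \<subseteq> A" for s A B
    using that unfolding acc_def by (meson order_trans)
  obtain D where D: "D \<subseteq> M" "infinite D"
    and dec: "\<And>s. finite s \<Longrightarrow> s \<subseteq> D \<Longrightarrow>
      acc s (beyond s D) \<or> (\<forall>B\<subseteq>beyond s D. infinite B \<longrightarrow> \<not> acc s B)"
  proof (rule fusion[OF M, of "\<lambda>s A. acc s A \<or> (\<forall>B\<subseteq>A. infinite B \<longrightarrow> \<not> acc s B)"])
    show "acc s B \<or> (\<forall>C\<subseteq>B. infinite C \<longrightarrow> \<not> acc s C)"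
      if "acc s A \<or> (\<forall>B\<subseteq>A. infinite B \<longrightarrow> \<not> acc s B)" "B \<subseteq> A" for s A B
      using that acc_mono by (meson order_trans)
    show "\<exists>B\<subseteq>A. infinite B \<and> (acc s B \<or> (\<forall>C\<subseteq>B. infinite C \<longrightarrow> \<not> acc s C))"
      if "infinite A" for s A
      using that by blast
  qed blast
  define rej where "rej s \<longleftrightarrow> \<not> acc s (beyond s D)" for s
  have rejD: "\<not> acc s B" if "rej s" "finite s" "s \<subseteq> D" "B \<subseteq> beyond s D" "infinite B" for s B
    using dec[of s] that unfolding rej_def by blast
  show thesis
  proof (cases "rej {}")
    case False
    then have "\<exists>j. F (N \<inter> {..<j})" if "N \<subseteq> D" "infinite N" for N
      using that by (auto simp: rej_def acc_def)
    then show thesis using D that by blast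
  next
    case rej0: True
    have fin: "finite {n \<in> beyond s D. \<not> rej (insert n s)}"
      if s: "rej s" "finite s" "s \<subseteq> D" for s
    proof (rule ccontr)
      define A where "A = {n \<in> beyond s D. \<not> rej (insert n s)}"
      assume "infinite {n \<in> beyond s D. \<not> rej (insert n s)}"
      then have A: "infinite A" by (simp add: A_def)
      have "acc s A"
        unfolding acc_def
      proof (intro allI impI)
        fix N assume N: "N \<subseteq> A" "infinite N" "\<forall>k\<in>s. \<forall>n\<in>N. k < n"
        define n where "n = (LEAST n. n \<in> N)"
        have "n \<in> N" unfolding n_def using N(2) by (metis LeastI_ex finite.emptyI equals0I)
        then have "\<not> rej (insert n s)" using N(1) by (auto simp: A_def)
        then have "acc (insert n s) (beyond (insert n s) D)" by (simp add: rej_def)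
        moreover have less: "k < m" if "k \<in> insert n s" "m \<in> N - {n}" for k m
          using that N(3) Least_le[of "\<lambda>n. n \<in> N" m] by (auto simp: n_def[symmetric])
        moreover have "N - {n} \<subseteq> beyond (insert n s) D"
          using less N(1) by (auto simp: beyond_def A_def)
        moreover have "infinite (N - {n})" using N(2) by simp
        ultimately obtain j where "F ((insert n s \<union> (N - {n})) \<inter> {..<j})"
          unfolding acc_def by blast
        moreover have "insert n s \<union> (N - {n}) = s \<union> N" using \<open>n \<in> N\<close> by blast
        ultimately show "\<exists>j. F ((s \<union> N) \<inter> {..<j})" by auto
      qed
      then show False using rejD[OF s _ A] by (auto simp: A_def)
    qed
    obtain L where L: "L \<subseteq> D" "infinite L"
      and ext: "\<And>s. finite s \<Longrightarrow> s \<subseteq> L \<Longrightarrow>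
        rej s \<longrightarrow> (\<forall>n\<in>beyond s L. n \<in> beyond s D \<longrightarrow> rej (insert n s))"
    proof (rule fusion[OF D(2), of "\<lambda>s A. rej s \<longrightarrow> (\<forall>n\<in>A. n \<in> beyond s D \<longrightarrow> rej (insert n s))"])
      show "\<exists>B\<subseteq>A. infinite B \<and> (rej s \<longrightarrow> (\<forall>n\<in>B. n \<in> beyond s D \<longrightarrow> rej (insert n s)))"
        if "finite s" "s \<subseteq> D" "infinite A" for s A
      proof (cases "rej s")
        case True
        have "infinite (A - {n \<in> beyond s D. \<not> rej (insert n s)})"
          using fin[OF True that(1,2)] that(3) by (rule Diff_infinite_finite)
        then show ?thesis by (intro exI[of _ "A - {n \<in> beyond s D. \<not> rej (insert n s)}"]) auto
      qed (use that in blast)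
    qed blast+
    have rejL: "rej s" if "finite s" "s \<subseteq> L" for s
      using that
    proof (induction s rule: finite_linorder_max_induct)
      case empty show ?case by (rule rej0)
    next
      case (insert b s)
      then have "b \<in> beyond s L" "b \<in> beyond s D" using L(1) by (auto simp: beyond_def)
      then show ?case using ext[of s] insert by blast
    qed
    have "\<not> F s" if s: "finite s" "s \<subseteq> L" for s
    proof
      assume F: "F s"
      have "acc s (beyond s D)"
        unfolding acc_def
      proof (intro allI impI)
        fix N assume N: "\<forall>k\<in>s. \<forall>n\<in>N. k < n"
        define j where "j = (if s = {} then 0 else Suc (Max s))"
        have "(s \<union> N) \<inter> {..<j} = s"
        proof (cases "s = {}")
          case True then show ?thesis by (simp add: j_def)
        next
          case False
          then have "Max s \<in> s" using s(1) by simp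
          then have lt: "Max s < n" if "n \<in> N" for n using N that by blast
          have "N \<inter> {..<j} = {}" using False by (auto simp: j_def less_Suc_eq_le dest: lt)
          moreover have "s \<subseteq> {..<j}" using s(1) False by (auto simp: j_def less_Suc_eq_le)
          ultimately show ?thesis by blast
        qed
        then show "\<exists>j. F ((s \<union> N) \<inter> {..<j})" using F by metis
      qed
      then show False using rejL[OF s] by (simp add: rej_def)
    qed
    then show thesis using L D(1) that[of L] by blast
  qed
qed

section \<open>Rosenthal's dichotomy\<close>

text \<open>
  Some subsequence converges to a number \<open>l\<close> to which the whole sequence does not converge, so
  infinitely many terms stay on one side of \<open>l\<close>, at a positive distance.
\<close>

lemma nonconvergent_oscillates:
  fixes a :: "nat \<Rightarrow> real"
  assumes bd: "bounded (range a)" and nc: "\<not> Cauchy a"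
  obtains r s :: rat where "r < s"
    "infinite {n. a n < of_rat r}" "infinite {n. of_rat s < a n}"
proof -
  obtain l \<sigma> where \<sigma>: "strict_mono \<sigma>" "(a \<circ> \<sigma>) \<longlonglongrightarrow> l"
    using bounded_imp_convergent_subsequence[OF bd] by blast
  have freq: "infinite {n. Q (a n)}" if "eventually Q (nhds l)" for Q
  proof -
    have "eventually (\<lambda>n. Q ((a \<circ> \<sigma>) n)) sequentially" using \<sigma>(2) that unfolding filterlim_iff by blast
    then obtain N where N: "\<And>n. n \<ge> N \<Longrightarrow> Q (a (\<sigma> n))"
      by (auto simp: eventually_sequentially)
    have "infinite (\<sigma> ` {N..})"
      using \<sigma>(1) by (simp add: finite_image_iff strict_mono_imp_inj_on infinite_Ici)
    then show ?thesis by (rule infinite_super[rotated]) (use N in auto)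
  qed
  have "\<not> a \<longlonglongrightarrow> l" using nc LIMSEQ_imp_Cauchy by blast
  then obtain e where e: "e > 0" "\<exists>\<^sub>F n in sequentially. e \<le> \<bar>a n - l\<bar>"
    unfolding tendsto_iff dist_real_def by (auto simp: not_eventually not_less)
  have "infinite {n. e \<le> \<bar>a n - l\<bar>}"
    using e(2) unfolding cofinite_eq_sequentially[symmetric] frequently_cofinite .
  moreover have "{n. e \<le> \<bar>a n - l\<bar>} \<subseteq> {n. l + e \<le> a n} \<union> {n. a n \<le> l - e}" by auto
  ultimately consider "infinite {n. l + e \<le> a n}" | "infinite {n. a n \<le> l - e}"
    by (meson finite_Un finite_subset)
  then show thesis
  proof cases
    case 1
    obtain r where r: "l < of_rat r" "of_rat r < l + e"
      using of_rat_dense[of l "l + e"] e(1) by auto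
    obtain s where s: "of_rat r < (of_rat s :: real)" "of_rat s < l + e"
      using of_rat_dense[OF r(2)] by auto
    have "infinite {n. a n < of_rat r}"
      using r(1) by (intro freq) (auto simp: eventually_nhds intro!: exI[of _ "{..<of_rat r}"])
    moreover have "infinite {n. of_rat s < a n}"
      using 1 by (rule infinite_super[rotated]) (use s(2) in auto)
    ultimately show thesis using s(1) by (intro that[of r s]) (auto simp: of_rat_less)
  next
    case 2
    obtain s where s: "l - e < of_rat s" "of_rat s < l"
      using of_rat_dense[of "l - e" l] e(1) by auto
    obtain r where r: "l - e < of_rat r" "of_rat r < (of_rat s :: real)"
      using of_rat_dense[OF s(1)] by auto
    have "infinite {n. of_rat s < a n}"
      using s(2) by (intro freq) (auto simp: eventually_nhds intro!: exI[of _ "{of_rat s<..}"])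
    moreover have "infinite {n. a n < of_rat r}"
      using 2 by (rule infinite_super[rotated]) (use r(1) in auto)
    ultimately show thesis using r(2) by (intro that[of r s]) (auto simp: of_rat_less)
  qed
qed

text \<open>
  Suppose that, for each rational interval, every infinite set of indices contained an infinite one
  without infinite oscillation across the interval at any point. Then a diagonal set for these
  countably many intervals would give a subsequence that converges at every point.
\<close>

lemma oscillation_on_all_subsequences:
  fixes h :: "nat \<Rightarrow> 'k \<Rightarrow> real"
  assumes bd: "\<And>f. f \<in> K \<Longrightarrow> bounded (range (\<lambda>n. h n f))"
    and nc: "\<And>\<rho>. strict_mono \<rho> \<Longrightarrow> \<exists>f\<in>K. \<not> Cauchy (\<lambda>n. h (\<rho> n) f)"
  obtains r s :: real and M where "r < s" "infinite M"
    "\<And>L. L \<subseteq> M \<Longrightarrow> infinite L \<Longrightarrow>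
      \<exists>f\<in>K. infinite {n \<in> L. s < h n f} \<and> infinite {n \<in> L. h n f < r}"
proof (rule ccontr)
  note found = that
  assume no: "\<not> thesis"
  define q :: "nat \<Rightarrow> rat \<times> rat" where "q = from_nat"
  define quiet where "quiet k L \<longleftrightarrow> (fst (q k) < snd (q k) \<longrightarrow>
    (\<forall>f\<in>K. finite {n \<in> L. of_rat (snd (q k)) < h n f} \<or> finite {n \<in> L. h n f < of_rat (fst (q k))}))"
    for k L
  obtain D where D: "infinite D"
    and qD: "\<And>t. finite t \<Longrightarrow> t \<subseteq> D \<Longrightarrow> quiet (card t) (beyond t D)"
  proof (rule fusion[OF infinite_UNIV_nat, of "\<lambda>t. quiet (card t)"])
    show "quiet (card t) B" if "quiet (card t) A" "B \<subseteq> A" for t A B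
    proof -
      have "{n \<in> B. c < h n f} \<subseteq> {n \<in> A. c < h n f}" "{n \<in> B. h n f < c} \<subseteq> {n \<in> A. h n f < c}"
        for c f using that(2) by auto
      then show ?thesis using that(1) unfolding quiet_def by (meson finite_subset)
    qed
    show "\<exists>B\<subseteq>A. infinite B \<and> quiet (card t) B" if "infinite A" for t A
    proof (cases "fst (q (card t)) < snd (q (card t))")
      case True
      then have "(of_rat (fst (q (card t))) :: real) < of_rat (snd (q (card t)))"
        by (simp add: of_rat_less)
      with no that show ?thesis
        using found[of "of_rat (fst (q (card t)))" "of_rat (snd (q (card t)))" A]
        unfolding quiet_def by meson
    next
      case False then show ?thesis using that by (auto simp: quiet_def)
    qed
  qed blast
  have all: "quiet k D" for k
  proof -
    obtain t where t: "finite t" "t \<subseteq> D" "card t = k"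
      using infinite_arbitrarily_large[OF D] by blast
    have eq: "finite {n \<in> D. Q n} \<longleftrightarrow> finite {n \<in> beyond t D. Q n}" for Q
    proof
      show "finite {n \<in> beyond t D. Q n}" if "finite {n \<in> D. Q n}"
        by (rule finite_subset[OF _ that]) (auto simp: beyond_def)
      show "finite {n \<in> D. Q n}" if "finite {n \<in> beyond t D. Q n}"
        by (rule finite_subset[OF _ finite_UnI[OF that finite_diff_beyond[OF t(1), of D]]]) auto
    qed
    show ?thesis using qD[OF t(1,2)] unfolding t(3) quiet_def eq .
  qed
  have mono: "strict_mono (enumerate D)" by (rule strict_mono_enumerate[OF D])
  then obtain f where f: "f \<in> K" "\<not> Cauchy (\<lambda>n. h (enumerate D n) f)" using nc by blast
  have "bounded (range (\<lambda>n. h (enumerate D n) f))"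
    by (rule bounded_subset[OF bd[OF f(1)]]) auto
  then obtain r s where rs: "r < s" "infinite {n. h (enumerate D n) f < of_rat r}"
    "infinite {n. of_rat s < h (enumerate D n) f}"
    using nonconvergent_oscillates f(2) by blast
  have osc: "infinite {n \<in> D. Q n}" if "infinite {n. Q (enumerate D n)}" for Q
  proof -
    have "infinite (enumerate D ` {n. Q (enumerate D n)})"
      using that mono by (simp add: finite_image_iff strict_mono_imp_inj_on inj_on_subset)
    then show ?thesis by (rule infinite_super[rotated]) (auto simp: enumerate_in_set D)
  qed
  note osc[of "\<lambda>n. h n f < of_rat r", OF rs(2)] osc[of "\<lambda>n. of_rat s < h n f", OF rs(3)]
  moreover obtain k where "q k = (r, s)" unfolding q_def by (metis from_nat_to_nat)
  ultimately show False using all[of k] rs(1) f(1) unfolding quiet_def by auto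
qed

text \<open>
  Galvin's lemma is applied to the finite sets along which \<open>P\<close> and \<open>Q\<close> cannot be made to alternate. A
  point at which both hold infinitely often shows that not all infinite sets have such an initial
  segment. So alternation is possible along all finite subsets of one infinite set, and
  skipping or including the elements with even index prescribes an arbitrary pattern at those with
  odd index.
\<close>

lemma independent_subsequence:
  fixes P Q :: "nat \<Rightarrow> 'k \<Rightarrow> bool"
  assumes M: "infinite M"
    and osc: "\<And>L. L \<subseteq> M \<Longrightarrow> infinite L \<Longrightarrow>
      \<exists>f\<in>K. infinite {n \<in> L. P n f} \<and> infinite {n \<in> L. Q n f}"
  obtains b :: "nat \<Rightarrow> nat" where "strict_mono b"
    "\<And>N \<sigma>. \<exists>f\<in>K. \<forall>k<N. if \<sigma> k then P (b k) f else Q (b k) f"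
proof -
  define alt where
    "alt s \<longleftrightarrow> (\<exists>f\<in>K. \<forall>n\<in>s. if even (card (s \<inter> {..<n})) then P n f else Q n f)" for s
  obtain L where L: "L \<subseteq> M" "infinite L"
    and dich: "(\<forall>s\<subseteq>L. finite s \<longrightarrow> alt s) \<or>
      (\<forall>N\<subseteq>L. infinite N \<longrightarrow> (\<exists>j. \<not> alt (N \<inter> {..<j})))"
    using galvin_lemma[OF M, of "\<lambda>s. \<not> alt s"] unfolding not_not by blast
  obtain f where f: "f \<in> K" "infinite {n \<in> L. P n f}" "infinite {n \<in> L. Q n f}"
    using osc[OF L] by blast
  have next_ex: "\<exists>y. (y \<in> L \<and> (if even (n :: nat) then P y f else Q y f)) \<and> x < y" for x n
    using f(2,3) unfolding infinite_nat_iff_unbounded by (cases "even n") auto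
  have "\<exists>c. \<forall>n. (c n \<in> L \<and> (if even n then P (c n) f else Q (c n) f)) \<and> c n < c (Suc n)"
    by (rule dependent_nat_choice) (use next_ex in blast)+
  then obtain c where
    "\<And>n. (c n \<in> L \<and> (if even n then P (c n) f else Q (c n) f)) \<and> c n < c (Suc n)" by blast
  then have c: "\<And>n. c n \<in> L" "\<And>n. if even n then P (c n) f else Q (c n) f" "strict_mono c"
    unfolding strict_mono_Suc_iff by blast+
  have "alt (range c \<inter> {..<j})" for j
    unfolding alt_def
  proof (intro bexI[of _ f] ballI)
    fix n assume n: "n \<in> range c \<inter> {..<j}"
    then obtain i where i: "n = c i" by blast
    have "c i < j" using n i by simp
    then have "range c \<inter> {..<j} \<inter> {..<c i} = range c \<inter> {..<c i}" by auto
    also have "\<dots> = c ` {..<i}" by (auto simp: strict_mono_less[OF c(3)])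
    finally have "card (range c \<inter> {..<j} \<inter> {..<c i}) = i"
      using c(3) by (simp add: card_image strict_mono_imp_inj_on inj_on_subset)
    then show "if even (card (range c \<inter> {..<j} \<inter> {..<n})) then P n f else Q n f"
      using c(2)[of i] by (simp add: i)
  qed (rule f(1))
  moreover have "range c \<subseteq> L" "infinite (range c)"
    using c(1,3) by (auto simp: finite_image_iff strict_mono_imp_inj_on)
  ultimately have good: "alt s" if "s \<subseteq> L" "finite s" for s using dich that by blast
  define l where "l = enumerate L"
  have l: "l n \<in> L" "l i < l j \<longleftrightarrow> i < j" "l i = l j \<longleftrightarrow> i = j" for n i j
    using L(2) strict_mono_enumerate[OF L(2)]
    by (auto simp: l_def enumerate_in_set strict_mono_less strict_mono_eq)
  define b where "b k = l (2 * k + 1)" for k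
  have pattern: "\<exists>s\<subseteq>l ` {..<2 * N}. \<forall>k<N. b k \<in> s \<and> even (card (s \<inter> {..<b k})) = \<sigma> k" for N \<sigma>
  proof (induction N)
    case 0 then show ?case by simp
  next
    case (Suc N)
    then obtain s where s: "s \<subseteq> l ` {..<2 * N}"
      "\<And>k. k < N \<Longrightarrow> b k \<in> s \<and> even (card (s \<inter> {..<b k})) = \<sigma> k" by blast
    have fin: "finite s" using s(1) finite_subset by blast
    have lt: "m < l (2 * N)" if "m \<in> s" for m using s(1) that by (auto simp: l)
    \<comment> \<open>The even index is a filler that corrects the parity of the number of smaller elements.\<close>
    define u where "u = (if even (card s) = \<sigma> N then s else insert (l (2 * N)) s)"
    have "l (2 * N) \<notin> s" using lt by blast
    then have ev: "even (card u) = \<sigma> N" using fin by (auto simp: u_def)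
    have ub: "m < b N" if "m \<in> u" for m
      using that lt[of m] l(2)[of "2 * N" "2 * N + 1"] by (auto simp: u_def b_def split: if_splits)
    define s' where "s' = insert (b N) u"
    have "s' \<inter> {..<b N} = u" using ub by (auto simp: s'_def)
    moreover have "s' \<inter> {..<b k} = s \<inter> {..<b k}" if "k < N" for k
    proof -
      have "b k < l (2 * N)" "b k < b N" using that by (auto simp: b_def l)
      then show ?thesis by (auto simp: s'_def u_def)
    qed
    moreover have "b k \<in> s'" if "k < Suc N" for k
      using that s(2)[of k] by (cases "k = N") (auto simp: s'_def u_def)
    moreover have "s' \<subseteq> l ` {..<2 * Suc N}"
      using s(1) by (auto simp: s'_def u_def b_def)
    ultimately show ?case using ev s(2)
      by (intro exI[of _ s']) (auto simp: less_Suc_eq)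
  qed
  show thesis
  proof
    show "strict_mono b" by (auto simp: strict_mono_def b_def l)
    fix N and \<sigma> :: "nat \<Rightarrow> bool"
    obtain s where s: "s \<subseteq> l ` {..<2 * N}"
      "\<And>k. k < N \<Longrightarrow> b k \<in> s \<and> even (card (s \<inter> {..<b k})) = \<sigma> k" using pattern by metis
    then have "alt s" using l(1) by (intro good) (auto intro: finite_subset)
    then show "\<exists>f\<in>K. \<forall>k<N. if \<sigma> k then P (b k) f else Q (b k) f"
      unfolding alt_def using s(2) by metis
  qed
qed

section \<open>Embeddings of the space of absolutely summable sequences\<close>

lemma ell1_nth_simps:
  "ell1_nth (a + b) n = ell1_nth a n + ell1_nth b n"
  "ell1_nth (r *\<^sub>R a) n = r * ell1_nth a n"
  "ell1_nth (a - b) n = ell1_nth a n - ell1_nth b n"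
  unfolding minus_ell1_def plus_ell1.rep_eq scaleR_ell1.rep_eq uminus_ell1.rep_eq by simp_all

lemma summable_ell1: "summable (\<lambda>n. \<bar>ell1_nth a n\<bar>)"
  using ell1_nth[of a] by simp

lemma norm_ell1_eq: "norm a = (\<Sum>n. \<bar>ell1_nth a n\<bar>)"
  by (rule norm_ell1.rep_eq)

lemma sum_le_norm_ell1: "(\<Sum>n<N. \<bar>ell1_nth a n\<bar>) \<le> norm a"
  unfolding norm_ell1_eq by (intro sum_le_suminf summable_ell1) auto

lemma norm_ell1_le:
  assumes "\<And>N. (\<Sum>n<N. \<bar>ell1_nth a n\<bar>) \<le> B"
  shows "norm a \<le> B"
  unfolding norm_ell1_eq by (intro suminf_le_const summable_ell1 assms)

lemma abs_ell1_nth_le: "\<bar>ell1_nth a n\<bar> \<le> norm a"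
proof -
  have "\<bar>ell1_nth a n\<bar> \<le> (\<Sum>k<Suc n. \<bar>ell1_nth a k\<bar>)" by (simp add: sum_nonneg)
  then show ?thesis using sum_le_norm_ell1[of a "Suc n"] by linarith
qed

text \<open>
  The limit is taken coordinatewise; bounds on finite sections of the differences pass to the limit
  in the second index.
\<close>

lemma Cauchy_ell1_convergent:
  fixes X :: "nat \<Rightarrow> ell1"
  assumes X: "Cauchy X"
  shows "convergent X"
proof -
  have "Cauchy (\<lambda>k. ell1_nth (X k) n)" for n
    unfolding Cauchy_norm_diff real_norm_def ell1_nth_simps(3)[symmetric]
    using X unfolding Cauchy_norm_diff by (meson abs_ell1_nth_le le_less_trans)
  then obtain l where l: "\<And>n. (\<lambda>k. ell1_nth (X k) n) \<longlonglongrightarrow> l n"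
    unfolding Cauchy_convergent_iff convergent_def by metis
  have tail: "(\<Sum>n<N. \<bar>ell1_nth (X m) n - l n\<bar>) \<le> e"
    if "\<And>k. k \<ge> M \<Longrightarrow> norm (X m - X k) \<le> e" for m M N e
  proof (rule LIMSEQ_le_const2)
    show "(\<lambda>k. \<Sum>n<N. \<bar>ell1_nth (X m) n - ell1_nth (X k) n\<bar>) \<longlonglongrightarrow>
        (\<Sum>n<N. \<bar>ell1_nth (X m) n - l n\<bar>)"
      by (intro tendsto_intros l)
    have "(\<Sum>n<N. \<bar>ell1_nth (X m) n - ell1_nth (X k) n\<bar>) \<le> norm (X m - X k)" for k
      using sum_le_norm_ell1[of "X m - X k" N] by (simp add: ell1_nth_simps)
    then show "\<exists>M. \<forall>k\<ge>M. (\<Sum>n<N. \<bar>ell1_nth (X m) n - ell1_nth (X k) n\<bar>) \<le> e"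
      using that by (meson order_trans)
  qed
  obtain M where M: "\<And>m k. m \<ge> M \<Longrightarrow> k \<ge> M \<Longrightarrow> norm (X m - X k) < 1"
    using X unfolding Cauchy_norm_diff by (meson zero_less_one)
  have B: "(\<Sum>n<N. \<bar>l n\<bar>) \<le> norm (X M) + 1" for N
  proof -
    have "\<bar>l n\<bar> \<le> \<bar>ell1_nth (X M) n\<bar> + \<bar>ell1_nth (X M) n - l n\<bar>" for n by linarith
    then have "(\<Sum>n<N. \<bar>l n\<bar>) \<le>
        (\<Sum>n<N. \<bar>ell1_nth (X M) n\<bar>) + (\<Sum>n<N. \<bar>ell1_nth (X M) n - l n\<bar>)"
      unfolding sum.distrib[symmetric] by (intro sum_mono)
    moreover have "(\<Sum>n<N. \<bar>ell1_nth (X M) n - l n\<bar>) \<le> 1"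
      by (rule tail[of M]) (use M[of M] in \<open>auto intro: less_imp_le\<close>)
    ultimately show ?thesis using sum_le_norm_ell1[of "X M" N] by linarith
  qed
  have "summable (\<lambda>n. \<bar>l n\<bar>)"
  proof (rule bounded_imp_summable)
    show "(\<Sum>n\<le>N. \<bar>l n\<bar>) \<le> norm (X M) + 1" for N
      using B[of "Suc N"] unfolding lessThan_Suc_atMost .
  qed auto
  then have a: "ell1_nth (Abs_ell1 l) = l" by (simp add: Abs_ell1_inverse)
  have "X \<longlonglongrightarrow> Abs_ell1 l"
  proof (rule LIMSEQ_I)
    fix e :: real assume e: "e > 0"
    obtain M where M: "\<And>m k. m \<ge> M \<Longrightarrow> k \<ge> M \<Longrightarrow> norm (X m - X k) < e / 2"
      using X e unfolding Cauchy_norm_diff by (meson half_gt_zero)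
    have "norm (X m - Abs_ell1 l) \<le> e / 2" if "m \<ge> M" for m
    proof (rule norm_ell1_le)
      show "(\<Sum>n<N. \<bar>ell1_nth (X m - Abs_ell1 l) n\<bar>) \<le> e / 2" for N
        unfolding ell1_nth_simps(3) a by (rule tail[of M]) (rule less_imp_le[OF M[OF that]])
    qed
    then show "\<exists>M. \<forall>m\<ge>M. norm (X m - Abs_ell1 l) < e" using e by fastforce
  qed
  then show ?thesis by (rule convergentI)
qed

lemma ell1_operator:
  fixes x :: "nat \<Rightarrow> 'a::banach"
  assumes x: "\<And>n. norm (x n) \<le> R"
  shows "(\<lambda>n. ell1_nth a n *\<^sub>R x n) sums (\<Sum>n. ell1_nth a n *\<^sub>R x n)"
    and "bounded_linear (\<lambda>a. \<Sum>n. ell1_nth a n *\<^sub>R x n)"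
proof -
  have le: "norm (ell1_nth a n *\<^sub>R x n) \<le> \<bar>ell1_nth a n\<bar> * R" for a n
    by (simp add: mult_left_mono x)
  have sR: "summable (\<lambda>n. \<bar>ell1_nth a n\<bar> * R)" for a
    by (intro summable_mult2 summable_ell1)
  have sn: "summable (\<lambda>n. norm (ell1_nth a n *\<^sub>R x n))" for a
    by (rule summable_comparison_test'[where N = 0, OF sR]) (use le in simp)
  have s: "summable (\<lambda>n. ell1_nth a n *\<^sub>R x n)" for a
    by (rule summable_norm_cancel[OF sn])
  then show "(\<lambda>n. ell1_nth a n *\<^sub>R x n) sums (\<Sum>n. ell1_nth a n *\<^sub>R x n)"
    by (rule summable_sums)
  show "bounded_linear (\<lambda>a. \<Sum>n. ell1_nth a n *\<^sub>R x n)"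
  proof
    show "(\<Sum>n. ell1_nth (a + b) n *\<^sub>R x n) =
        (\<Sum>n. ell1_nth a n *\<^sub>R x n) + (\<Sum>n. ell1_nth b n *\<^sub>R x n)" for a b
      using s by (simp add: ell1_nth_simps scaleR_left_distrib suminf_add)
    show "(\<Sum>n. ell1_nth (r *\<^sub>R a) n *\<^sub>R x n) = r *\<^sub>R (\<Sum>n. ell1_nth a n *\<^sub>R x n)" for r a
      by (simp add: ell1_nth_simps suminf_scaleR_right[OF s])
    have "norm (\<Sum>n. ell1_nth a n *\<^sub>R x n) \<le> norm a * R" for a
    proof -
      have "norm (\<Sum>n. ell1_nth a n *\<^sub>R x n) \<le> (\<Sum>n. norm (ell1_nth a n *\<^sub>R x n))"
        by (rule summable_norm[OF sn])
      also have "\<dots> \<le> (\<Sum>n. \<bar>ell1_nth a n\<bar> * R)" by (intro suminf_le le sn sR)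
      also have "\<dots> = norm a * R" by (simp add: norm_ell1_eq suminf_mult2[OF summable_ell1])
      finally show ?thesis .
    qed
    then show "\<exists>K. \<forall>a. norm (\<Sum>n. ell1_nth a n *\<^sub>R x n) \<le> norm a * K" by blast
  qed
qed

lemma contains_ell1I:
  fixes x :: "nat \<Rightarrow> 'a::banach"
  assumes x: "\<And>n. norm (x n) \<le> R" and c: "c > 0"
    and lower: "\<And>N a. c * (\<Sum>k<N. \<bar>a k\<bar>) \<le> norm (\<Sum>k<N. a k *\<^sub>R x k)"
  shows "contains_ell1 TYPE('a)"
proof -
  define T where "T a = (\<Sum>n. ell1_nth a n *\<^sub>R x n)" for a
  note sums = ell1_operator(1)[of x R, OF x, folded T_def]
  have T: "bounded_linear T" unfolding T_def by (rule ell1_operator(2)[of x R, OF x])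
  interpret T: bounded_linear T by (rule T)
  have low: "c * norm a \<le> norm (T a)" for a
  proof (rule LIMSEQ_le)
    show "(\<lambda>N. c * (\<Sum>k<N. \<bar>ell1_nth a k\<bar>)) \<longlonglongrightarrow> c * norm a"
      unfolding norm_ell1_eq by (intro tendsto_mult_left summable_LIMSEQ summable_ell1)
    show "(\<lambda>N. norm (\<Sum>k<N. ell1_nth a k *\<^sub>R x k)) \<longlonglongrightarrow> norm (T a)"
      using sums[of a] unfolding sums_def by (rule tendsto_norm)
  qed (use lower in auto)
  have inj: "inj T"
  proof (rule injI)
    fix a b assume "T a = T b"
    then have "c * norm (a - b) \<le> 0" using low[of "a - b"] by (simp add: T.diff)
    then have "norm (a - b) \<le> 0" using c by (simp add: mult_le_0_iff)
    then show "a = b" by simp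
  qed
  have "complete (range T)"
  proof (rule complete_isometric_image[OF c _ T])
    show "\<forall>a\<in>UNIV. c * norm a \<le> norm (T a)" using low by blast
    show "complete (UNIV :: ell1 set)"
      using Cauchy_ell1_convergent by (auto simp: complete_def convergent_def)
  qed auto
  then have "closed (range T)" by (rule complete_imp_closed)
  moreover have "subspace (range T)"
    using T.linear by (intro linear_subspace_image) (auto simp: linear_iff)
  moreover have "homeomorphism UNIV (range T) T (inv T)"
  proof (rule homeomorphismI)
    show "continuous_on UNIV T" by (intro linear_continuous_on T)
    show "continuous_on (range T) (inv T)"
      unfolding continuous_on_iff
    proof (intro ballI allI impI)
      fix y and e :: real assume y: "y \<in> range T" and e: "e > 0"
      have "dist (inv T z) (inv T y) < e" if z: "z \<in> range T" "dist z y < c * e" for z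
      proof -
        obtain a b where ab: "z = T a" "y = T b" using y z(1) by blast
        have "c * norm (a - b) < c * e"
          using low[of "a - b"] z(2) by (simp add: ab T.diff dist_norm)
        then show ?thesis using c by (simp add: ab inv_f_f[OF inj] dist_norm)
      qed
      then show "\<exists>d>0. \<forall>z\<in>range T. dist z y < d \<longrightarrow> dist (inv T z) (inv T y) < e"
        using c e by (intro exI[of _ "c * e"]) auto
    qed
  qed (auto simp: inv_f_f[OF inj])
  ultimately show ?thesis
    unfolding contains_ell1_def using T.linear by blast
qed

text \<open>
  A linear homeomorphism onto a subspace and its inverse are continuous at zero and therefore, by
  homogeneity, bounded.
\<close>

lemma contains_ell1E:
  assumes "contains_ell1 TYPE('a::banach)"
  obtains T :: "ell1 \<Rightarrow> 'a::banach" and C where "bounded_linear T" "C > 0" "\<And>a. norm a \<le> C * norm (T a)"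
proof -
  obtain S :: "'a set" and T :: "ell1 \<Rightarrow> 'a" and g where S: "subspace S" and T: "linear T"
    and h: "homeomorphism UNIV S T g"
    using assms unfolding contains_ell1_def by (elim exE conjE) (rule that)
  interpret T: linear T by (rule T)
  have scale: "\<exists>K>0. \<forall>a. q a \<le> K * p a"
    if d: "d > 0" "\<And>a. p a < d \<Longrightarrow> q a < 1"
      and hom: "\<And>r a. r > 0 \<Longrightarrow> p (r *\<^sub>R a) = r * p a" "\<And>r a. r > 0 \<Longrightarrow> q (r *\<^sub>R a) = r * q a"
      and nn: "\<And>a. p a \<ge> 0"
    for p q :: "ell1 \<Rightarrow> real" and d
  proof (intro exI conjI allI)
    show "2 / d > 0" using d by simp
    fix a
    show "q a \<le> 2 / d * p a"
    proof (rule field_le_epsilon)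
      fix e :: real assume e: "e > 0"
      define r where "r = 2 / d * p a + e"
      have r: "r > 0" using e d nn[of a] by (simp add: r_def add_nonneg_pos)
      have "d * r = 2 * p a + d * e" using d(1) by (simp add: r_def distrib_left)
      moreover have "d * e > 0" using d(1) e by simp
      ultimately have "p a < d * r" using nn[of a] by linarith
      then have "p (inverse r *\<^sub>R a) < d" using r by (simp add: hom field_simps)
      then have "q (inverse r *\<^sub>R a) < 1" by (rule d(2))
      then have "q a < r" using r by (simp add: hom field_simps)
      then show "q a \<le> 2 / d * p a + e" by (simp add: r_def)
    qed
  qed
  have "isCont T 0" using h by (simp add: homeomorphism_def continuous_on_eq_continuous_at)
  then obtain d where d: "d > 0" "\<And>a. norm a < d \<Longrightarrow> norm (T a) < 1"
    unfolding continuous_at_eps_delta dist_norm T.zero diff_zero by (meson zero_less_one)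
  obtain K where "\<And>a. norm (T a) \<le> K * norm a"
    using scale[of d norm "\<lambda>a. norm (T a)"] d by (auto simp: T.scaleR)
  then have bl: "bounded_linear T"
    using T by (auto simp: bounded_linear_def bounded_linear_axioms_def mult.commute)
  have g0: "g 0 = 0" "0 \<in> S"
    using h S by (auto simp: homeomorphism_def subspace_0 T.zero) (metis T.zero UNIV_I)
  have "continuous_on S g" using h by (simp add: homeomorphism_def)
  then obtain d' where d': "d' > 0" "\<And>y. y \<in> S \<Longrightarrow> norm y < d' \<Longrightarrow> norm (g y) < 1"
    unfolding continuous_on_iff dist_norm using g0 by (metis diff_zero zero_less_one)
  have "norm a < 1" if "norm (T a) < d'" for a
    using d'(2)[of "T a"] that h by (auto simp: homeomorphism_def)
  then obtain C where "C > 0" "\<And>a. norm a \<le> C * norm (T a)"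
    using scale[of d' "\<lambda>a. norm (T a)" norm] d'(1) by (auto simp: T.scaleR)
  then show thesis using bl that by blast
qed

text \<open>
  Along an independent sequence, for scalars \<open>a\<close> there are two functionals in the unit ball that
  differ on the \<open>k\<close>-th vector by at least \<open>s - r\<close>, with the sign of \<open>a k\<close>. Hence the vectors
  generate a copy of \<open>\<ell>\<^sub>1\<close>.
\<close>

lemma weakly_precompact_unit_ball_if_no_ell1:
  assumes no: "\<not> contains_ell1 TYPE('a::banach)"
  shows "weakly_precompact (cball 0 1 :: 'a::banach set)"
  unfolding weakly_precompact_def
proof (intro allI impI, rule ccontr)
  fix x :: "nat \<Rightarrow> 'a" assume "range x \<subseteq> cball 0 1"
  then have x: "norm (x n) \<le> 1" for n by (auto simp: image_subset_iff)
  assume none: "\<nexists>\<rho>. strict_mono \<rho> \<and> weakly_Cauchy (x \<circ> \<rho>)"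
  define K where "K = {f :: 'a \<Rightarrow>\<^sub>L real. norm f \<le> 1}"
  have "bounded (range (\<lambda>n. blinfun_apply f (x n)))" if "f \<in> K" for f
  proof -
    have "norm (blinfun_apply f (x n)) \<le> 1" for n
      using norm_blinfun[of f "x n"] mult_mono[of "norm f" 1 "norm (x n)" 1] that x[of n]
      by (simp add: K_def)
    then show ?thesis by (auto simp: bounded_iff)
  qed
  moreover have "\<exists>f\<in>K. \<not> Cauchy (\<lambda>n. blinfun_apply f (x (\<rho> n)))" if "strict_mono \<rho>" for \<rho>
  proof -
    have "\<not> weakly_Cauchy (x \<circ> \<rho>)" using none that by blast
    then obtain f :: "'a \<Rightarrow>\<^sub>L real" where f: "\<not> Cauchy (\<lambda>n. blinfun_apply f (x (\<rho> n)))"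
      by (auto simp: weakly_Cauchy_def)
    \<comment> \<open>The summand 1 keeps the divisor positive also for the zero functional.\<close>
    define t where "t = 1 + norm f"
    have t: "t > 0" by (simp add: t_def add_pos_nonneg)
    have "inverse t *\<^sub>R f \<in> K" using t by (simp add: K_def t_def field_simps)
    moreover have "\<not> Cauchy (\<lambda>n. blinfun_apply (inverse t *\<^sub>R f) (x (\<rho> n)))"
    proof
      assume "Cauchy (\<lambda>n. blinfun_apply (inverse t *\<^sub>R f) (x (\<rho> n)))"
      from Cauchy_scale[OF this, of t] show False
        using f t by (simp add: blinfun.scaleR_left mult.assoc[symmetric])
    qed
    ultimately show ?thesis by blast
  qed
  ultimately obtain r s M where rs: "r < s" "infinite M"
    "\<And>L. L \<subseteq> M \<Longrightarrow> infinite L \<Longrightarrow> \<exists>f\<in>K. infinite {n \<in> L. s < blinfun_apply f (x n)} \<and>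
      infinite {n \<in> L. blinfun_apply f (x n) < r}"
    using oscillation_on_all_subsequences[of K "\<lambda>n f. blinfun_apply f (x n)"] by blast
  obtain b :: "nat \<Rightarrow> nat" where "strict_mono b" and b: "\<And>N \<sigma>. \<exists>f\<in>K. \<forall>k<N.
      if \<sigma> k then s < blinfun_apply f (x (b k)) else blinfun_apply f (x (b k)) < r"
  proof (rule independent_subsequence[OF rs(2), of K "\<lambda>n f. s < blinfun_apply f (x n)"
        "\<lambda>n f. blinfun_apply f (x n) < r"])
    show "\<exists>f\<in>K. infinite {n \<in> L. s < blinfun_apply f (x n)} \<and>
        infinite {n \<in> L. blinfun_apply f (x n) < r}" if "L \<subseteq> M" "infinite L" for L
      by (rule rs(3)[OF that])
  qed (rule that)
  have "contains_ell1 TYPE('a)"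
  proof (rule contains_ell1I[of "\<lambda>k. x (b k)" 1 "(s - r) / 2"])
    fix N and a :: "nat \<Rightarrow> real"
    obtain f where f: "f \<in> K" "\<forall>k<N. if a k \<ge> 0 then s < blinfun_apply f (x (b k))
        else blinfun_apply f (x (b k)) < r"
      using b[of N "\<lambda>k. a k \<ge> 0"] by blast
    obtain g where g: "g \<in> K" "\<forall>k<N. if \<not> a k \<ge> 0 then s < blinfun_apply g (x (b k))
        else blinfun_apply g (x (b k)) < r"
      using b[of N "\<lambda>k. \<not> a k \<ge> 0"] by blast
    \<comment> \<open>\<open>f\<close> follows the signs of the coefficients and \<open>g\<close> the opposite ones.\<close>
    let ?v = "\<Sum>k<N. a k *\<^sub>R x (b k)"
    have coord: "(s - r) * \<bar>a k\<bar> \<le> a k * blinfun_apply (f - g) (x (b k))" if "k < N" for k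
    proof (cases "a k \<ge> 0")
      case True
      then have "s - r \<le> blinfun_apply (f - g) (x (b k))"
        using f(2) g(2) that by (force simp: blinfun.diff_left)
      from mult_right_mono[OF this True] True show ?thesis by (simp add: mult.commute)
    next
      case False
      then have "s - r \<le> - blinfun_apply (f - g) (x (b k))"
        using f(2) g(2) that by (force simp: blinfun.diff_left)
      from mult_right_mono[OF this, of "- a k"] False show ?thesis by (simp add: mult.commute)
    qed
    have "(s - r) * (\<Sum>k<N. \<bar>a k\<bar>) \<le> (\<Sum>k<N. a k * blinfun_apply (f - g) (x (b k)))"
      unfolding sum_distrib_left by (intro sum_mono coord) auto
    also have "\<dots> = blinfun_apply (f - g) ?v"
      by (simp add: blinfun.sum_right blinfun.scaleR_right)
    also have "\<dots> \<le> norm (f - g) * norm ?v"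
      using norm_blinfun[of "f - g" ?v] by simp
    also have "\<dots> \<le> 2 * norm ?v"
      using f(1) g(1) norm_triangle_ineq4[of f g] by (intro mult_right_mono) (auto simp: K_def)
    finally show "(s - r) / 2 * (\<Sum>k<N. \<bar>a k\<bar>) \<le> norm ?v" by simp
  qed (use x rs(1) in auto)
  then show False using no by simp
qed

section \<open>Means along an ultrafilter\<close>

text \<open>
  Of a free ultrafilter on the natural numbers, only its effect on bounded real sequences is
  required.
\<close>

locale generalized_limit =
  fixes F :: "nat filter"
  assumes F_nontrivial: "F \<noteq> bot"
    and F_sequentially: "F \<le> sequentially"
    and F_limit: "\<And>a :: nat \<Rightarrow> real. bounded (range a) \<Longrightarrow> \<exists>l. (a \<longlongrightarrow> l) F"

text \<open>
  The evaluations of bounded sequences at \<open>0\<close>, \<open>1\<close>, \<open>2\<close>, ... are points of a cube, which is compact by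
  Tychonoff's theorem. Their approach to a cluster point \<open>L\<close> is a filter along which each bounded
  sequence \<open>a\<close> converges to \<open>L a\<close>.
\<close>

lemma generalized_limit_exists: "\<exists>F. generalized_limit F"
proof -
  \<comment> \<open>Unbounded sequences are sent to 0 to keep the evaluations inside a cube.\<close>
  define ev where "ev N a = (if bounded (range a) then a N else 0)" for N and a :: "nat \<Rightarrow> real"
  have "\<exists>b. \<forall>N. \<bar>ev N a\<bar> \<le> b" for a
  proof (cases "bounded (range a)")
    case True then show ?thesis by (auto simp: ev_def bounded_iff)
  next
    case False then show ?thesis by (intro exI[of _ 0]) (simp add: ev_def)
  qed
  then obtain b where b: "\<And>a N. \<bar>ev N a\<bar> \<le> b a" by metis
  define Q where "Q = PiE UNIV (\<lambda>a. {- b a..b a})"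
  have "compactin (product_topology (\<lambda>_. euclidean) UNIV) Q"
    unfolding Q_def compactin_PiE by simp
  then have "compact Q" by (simp add: euclidean_product_topology)
  moreover have "filtermap ev sequentially \<noteq> bot" by (simp add: filtermap_bot_iff)
  moreover have "ev N \<in> Q" for N
    using b by (auto simp: Q_def abs_le_iff) (metis abs_le_iff minus_le_iff)
  then have "\<forall>\<^sub>F u in filtermap ev sequentially. u \<in> Q" by (simp add: eventually_filtermap)
  ultimately obtain L where L: "inf (nhds L) (filtermap ev sequentially) \<noteq> bot"
    unfolding compact_filter by blast
  define F where "F = inf sequentially (filtercomap ev (nhds L))"
  have "generalized_limit F"
  proof
    show "F \<le> sequentially" by (simp add: F_def)
    show "F \<noteq> bot"
    proof
      assume "F = bot"
      then obtain P R where P: "eventually P sequentially" and R: "eventually R (nhds L)"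
        and PR: "\<And>N. P N \<Longrightarrow> R (ev N) \<Longrightarrow> False"
        unfolding F_def trivial_limit_def eventually_inf eventually_filtercomap by blast
      have "eventually (\<lambda>u. \<not> R u) (filtermap ev sequentially)"
        unfolding eventually_filtermap using P by (rule eventually_mono) (use PR in blast)
      with R have "eventually (\<lambda>_. False) (inf (nhds L) (filtermap ev sequentially))"
        unfolding eventually_inf by blast
      then show False using L by (simp add: trivial_limit_def)
    qed
    fix a :: "nat \<Rightarrow> real" assume a: "bounded (range a)"
    have "filterlim ev (nhds L) F"
      unfolding F_def by (rule filterlim_mono[OF filterlim_filtercomap order_refl inf_le2])
    then have "((\<lambda>N. ev N a) \<longlongrightarrow> L a) F"
      by (rule continuous_on_tendsto_compose[OF continuous_on_product_coordinates]) auto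
    then show "\<exists>l. (a \<longlongrightarrow> l) F" using a by (auto simp: ev_def)
  qed
  then show ?thesis by blast
qed

text \<open>
  Averages over blocks of dyadic length: there the binary digits of the index are independent signs.
\<close>

definition avg :: "nat \<Rightarrow> (nat \<Rightarrow> real) \<Rightarrow> real" where
  "avg N h = (\<Sum>i<2 ^ N. h i) / 2 ^ N"

lemma abs_avg_le:
  assumes "\<And>i. \<bar>h i\<bar> \<le> B"
  shows "\<bar>avg N h\<bar> \<le> B"
proof -
  have "\<bar>\<Sum>i<2 ^ N. h i\<bar> \<le> (\<Sum>i<(2::nat) ^ N. B)"
    by (intro order_trans[OF sum_abs] sum_mono assms)
  then show ?thesis by (simp add: avg_def field_simps)
qed

lemma avg_simps:
  "avg N (\<lambda>i. g i + h i) = avg N g + avg N h"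
  "avg N (\<lambda>i. c * h i) = c * avg N h"
  "avg N (\<lambda>_. c) = c"
  by (simp_all add: avg_def sum.distrib add_divide_distrib sum_distrib_left)

lemma avg_mono: "(\<And>i. g i \<le> h i) \<Longrightarrow> avg N g \<le> avg N h"
  unfolding avg_def by (intro divide_right_mono sum_mono) auto

context generalized_limit
begin

definition glim :: "(nat \<Rightarrow> real) \<Rightarrow> real" where
  "glim a = Lim F a"

lemma glim_eqI: "(a \<longlongrightarrow> l) F \<Longrightarrow> glim a = l"
  unfolding glim_def using F_nontrivial by (rule tendsto_Lim)

lemma glim_tendsto:
  assumes "\<And>n. \<bar>a n\<bar> \<le> B"
  shows "(a \<longlongrightarrow> glim a) F"
proof -
  have "bounded (range a)" using assms by (auto simp: bounded_iff)
  then obtain l where "(a \<longlongrightarrow> l) F" using F_limit by blast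
  then show ?thesis using glim_eqI by simp
qed

definition mean :: "(nat \<Rightarrow> real) \<Rightarrow> real" where
  "mean h = glim (\<lambda>N. avg N h)"

lemma mean_tendsto:
  assumes "\<And>i. \<bar>h i\<bar> \<le> B"
  shows "((\<lambda>N. avg N h) \<longlongrightarrow> mean h) F"
  unfolding mean_def by (rule glim_tendsto[OF abs_avg_le[OF assms]])

lemma mean_eqI: "((\<lambda>N. avg N h) \<longlongrightarrow> l) F \<Longrightarrow> mean h = l"
  unfolding mean_def by (rule glim_eqI)

lemma mean_const: "mean (\<lambda>_. c) = c"
  by (rule mean_eqI) (simp add: avg_simps)

lemma mean_add:
  assumes "\<And>i. \<bar>g i\<bar> \<le> B" "\<And>i. \<bar>h i\<bar> \<le> C"
  shows "mean (\<lambda>i. g i + h i) = mean g + mean h"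
  by (rule mean_eqI) (simp add: avg_simps tendsto_add mean_tendsto[OF assms(1)] mean_tendsto[OF assms(2)])

lemma mean_mult:
  assumes "\<And>i. \<bar>h i\<bar> \<le> B"
  shows "mean (\<lambda>i. c * h i) = c * mean h"
  by (rule mean_eqI) (simp add: avg_simps tendsto_mult_left mean_tendsto[OF assms])

lemma mean_mono:
  assumes "\<And>i. \<bar>g i\<bar> \<le> B" "\<And>i. \<bar>h i\<bar> \<le> C" "\<And>i. g i \<le> h i"
  shows "mean g \<le> mean h"
  by (rule tendsto_le[OF F_nontrivial mean_tendsto[OF assms(2)] mean_tendsto[OF assms(1)]])
    (simp add: avg_mono assms(3))

lemma abs_mean_le:
  assumes "\<And>i. \<bar>h i\<bar> \<le> B"
  shows "\<bar>mean h\<bar> \<le> B"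
proof (rule tendsto_upperbound[OF _ _ F_nontrivial])
  show "((\<lambda>N. \<bar>avg N h\<bar>) \<longlongrightarrow> \<bar>mean h\<bar>) F" by (intro tendsto_rabs mean_tendsto[OF assms])
qed (simp add: abs_avg_le assms)

definition weight :: "nat set \<Rightarrow> real" where
  "weight A = mean (indicator A)"

lemma abs_indicator_le: "\<bar>indicator A i :: real\<bar> \<le> 1"
  by (simp add: indicator_def)

lemma weight_le_1: "weight A \<le> 1"
  using abs_mean_le[of "indicator A" 1] abs_indicator_le by (simp add: weight_def abs_le_iff)

lemma weight_mono: "A \<subseteq> B \<Longrightarrow> weight A \<le> weight B"
  unfolding weight_def
  by (rule mean_mono[OF abs_indicator_le abs_indicator_le]) (auto simp: indicator_def)

lemma weight_Un_disjoint:
  assumes "A \<inter> B = {}"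
  shows "weight (A \<union> B) = weight A + weight B"
proof -
  have "indicator (A \<union> B) = (\<lambda>i. indicator A i + indicator B i :: real)"
    using assms by (auto simp: indicator_def fun_eq_iff)
  then show ?thesis
    unfolding weight_def by (simp add: mean_add[OF abs_indicator_le abs_indicator_le])
qed

text \<open>
  For a mean that is only finitely additive, a sequence of sets of weight at least \<open>\<eta>\<close> need not
  have points in infinitely many of its members. However, one may choose finite unions \<open>U n\<close> of
  members with indices above \<open>n\<close> that nearly exhaust the weight of all such unions. Then the part
  of \<open>U n\<close> outside \<open>U j\<close> is negligible for \<open>j \<le> n\<close>, and so finitely many \<open>U j\<close> have common points.
\<close>

lemma finite_unions_meet:
  fixes A :: "nat \<Rightarrow> nat set"
  assumes \<eta>: "\<eta> > 0" and A: "\<And>k. \<eta> \<le> weight (A k)"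
  obtains M where "\<And>n. (\<Inter>j\<in>{..n}. \<Union>k\<in>{j..M j}. A k) \<noteq> {}"
proof -
  define e where "e n = (SUP M. weight (\<Union>k\<in>{n..M}. A k))" for n
  have bdd: "bdd_above (range (\<lambda>M. weight (\<Union>k\<in>{n..M}. A k)))" for n
    by (intro bdd_aboveI2[of _ _ 1] weight_le_1)
  have e: "weight (\<Union>k\<in>{n..M}. A k) \<le> e n" for n M
    unfolding e_def by (intro cSUP_upper bdd) auto
  \<comment> \<open>The tolerances add up to less than \<open>\<eta> / 2\<close>, and \<open>M \<ge> n\<close> makes \<open>A n\<close> one of the members united.\<close>
  have "\<exists>M\<ge>n. e n - \<eta> / 2 * (1 / 2) ^ Suc n < weight (\<Union>k\<in>{n..M}. A k)" for n
  proof -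
    have "e n - \<eta> / 2 * (1 / 2) ^ Suc n < e n" using \<eta> by simp
    then obtain M where "e n - \<eta> / 2 * (1 / 2) ^ Suc n < weight (\<Union>k\<in>{n..M}. A k)"
      unfolding e_def using bdd[of n] by (meson less_cSUP_iff UNIV_not_empty UNIV_I)
    also have "\<dots> \<le> weight (\<Union>k\<in>{n..max n M}. A k)" by (intro weight_mono UN_mono) auto
    finally show ?thesis by (intro exI[of _ "max n M"]) auto
  qed
  then obtain M where Mn: "\<And>n. n \<le> M n"
    and M: "\<And>n. e n - \<eta> / 2 * (1 / 2) ^ Suc n < weight (\<Union>k\<in>{n..M n}. A k)"
    by metis
  define U where "U n = (\<Union>k\<in>{n..M n}. A k)" for n
  have diff: "weight (U n - U j) \<le> \<eta> / 2 * (1 / 2) ^ Suc j" if "j \<le> n" for j n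
  proof -
    have "U j \<union> (U n - U j) \<subseteq> (\<Union>k\<in>{j..max (M j) (M n)}. A k)"
      using that by (fastforce simp: U_def)
    then have "weight (U j \<union> (U n - U j)) \<le> e j" using e weight_mono order_trans by blast
    then show ?thesis using M[of j] by (subst (asm) weight_Un_disjoint) (auto simp: U_def)
  qed
  have U: "\<eta> \<le> weight (U n)" for n
    using A[of n] weight_mono[of "A n" "U n"] Mn[of n] by (fastforce simp: U_def)
  \<comment> \<open>\<open>U n\<close> loses at most the sum of the tolerances when it is intersected with the earlier unions.\<close>
  have outside: "weight (U n - (\<Inter>j\<in>{..<i}. U j)) \<le> \<eta> / 2 * (1 - (1 / 2) ^ i)"
    if "i \<le> Suc n" for i n
    using that
  proof (induction i)
    case 0
    have "weight {} = 0" using weight_Un_disjoint[of "{}" "{}"] by simp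
    then show ?case by simp
  next
    case (Suc i)
    let ?I = "\<Inter>j\<in>{..<i}. U j"
    have "U n - (\<Inter>j\<in>{..<Suc i}. U j) = (U n - ?I) \<union> ((U n - U i) \<inter> ?I)"
      by (auto simp: less_Suc_eq)
    then have "weight (U n - (\<Inter>j\<in>{..<Suc i}. U j)) =
        weight (U n - ?I) + weight ((U n - U i) \<inter> ?I)"
      by (simp only:, intro weight_Un_disjoint) blast
    also have "weight ((U n - U i) \<inter> ?I) \<le> weight (U n - U i)" by (intro weight_mono) blast
    also have "\<dots> \<le> \<eta> / 2 * (1 / 2) ^ Suc i" using Suc.prems by (intro diff) simp
    also have "weight (U n - ?I) \<le> \<eta> / 2 * (1 - (1 / 2) ^ i)" using Suc by simp
    finally show ?case by (simp add: field_simps)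
  qed
  show thesis
  proof
    fix n
    show "(\<Inter>j\<in>{..n}. \<Union>k\<in>{j..M j}. A k) \<noteq> {}"
      unfolding U_def[symmetric]
    proof
      assume "(\<Inter>j\<in>{..n}. U j) = {}"
      then have "weight (U n) \<le> \<eta> / 2 * (1 - (1 / 2) ^ Suc n)"
        using outside[of "Suc n" n] by (simp add: lessThan_Suc_atMost)
      also have "\<dots> < \<eta>" using \<eta> by (simp add: field_simps add_pos_pos)
      finally show False using U[of n] by simp
    qed
  qed
qed

text \<open>
  A substitute for the dominated convergence theorem, the mean being only finitely additive. If the
  means stay above \<open>\<delta>\<close>, then the sets \<open>A k\<close> of indices \<open>i\<close> at which \<open>f i\<close> is large on \<open>v k\<close> have
  weights bounded below. Choosing common points of more and more of the finite unions and passing to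
  the limit of the corresponding functionals yields one functional that is large on infinitely
  many \<open>v k\<close>.
\<close>

lemma mean_small_on_weakly_null:
  fixes f :: "nat \<Rightarrow> 'a::real_normed_vector \<Rightarrow> real"
  assumes lin: "\<And>i. linear (f i)" and bd: "\<And>i z. \<bar>f i z\<bar> \<le> C * norm z"
    and v: "weakly_null v" and \<delta>: "\<delta> > 0"
  shows "\<exists>k. mean (\<lambda>i. \<bar>f i (v k)\<bar>) < \<delta>"
proof (rule ccontr)
  assume "\<not> ?thesis"
  then have ge: "\<delta> \<le> mean (\<lambda>i. \<bar>f i (v k)\<bar>)" for k by (simp add: not_less)
  obtain R where R: "\<And>k. norm (v k) \<le> R" using weakly_null_bounded[OF v] by blast
  define B where "B = 1 + \<bar>C\<bar> * \<bar>R\<bar>"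
  have B: "B > 0" by (simp add: B_def add_pos_nonneg)
  have fB: "\<bar>f i (v k)\<bar> \<le> B" for i k
  proof -
    have "C * norm (v k) \<le> \<bar>C\<bar> * \<bar>R\<bar>"
      using R[of k] by (intro mult_mono) auto
    then show ?thesis using bd[of i "v k"] by (simp add: B_def)
  qed
  define A where "A k = {i. \<delta> / 2 \<le> \<bar>f i (v k)\<bar>}" for k
  have A: "\<delta> / (2 * B) \<le> weight (A k)" for k
  proof -
    have Bind: "\<bar>B * indicator (A k) i\<bar> \<le> B" for i using B by (simp add: indicator_def)
    have "mean (\<lambda>i. \<bar>f i (v k)\<bar>) \<le> mean (\<lambda>i. \<delta> / 2 + B * indicator (A k) i)"
    proof (rule mean_mono)
      show "\<bar>\<bar>f i (v k)\<bar>\<bar> \<le> B" for i using fB by simp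
      show "\<bar>\<delta> / 2 + B * indicator (A k) i\<bar> \<le> \<delta> / 2 + B" for i
        using \<delta> B by (simp add: indicator_def)
      show "\<bar>f i (v k)\<bar> \<le> \<delta> / 2 + B * indicator (A k) i" for i
        using fB[of i k] \<delta> by (auto simp: A_def indicator_def)
    qed
    also have "\<dots> = \<delta> / 2 + B * weight (A k)"
      unfolding weight_def mean_mult[OF abs_indicator_le, symmetric]
      by (subst mean_add[where B = "\<bar>\<delta> / 2\<bar>", OF _ Bind]) (simp_all add: mean_const)
    finally show ?thesis using ge[of k] B by (simp add: field_simps)
  qed
  obtain M where M: "\<And>n. (\<Inter>j\<in>{..n}. \<Union>k\<in>{j..M j}. A k) \<noteq> {}"
    using finite_unions_meet[of "\<delta> / (2 * B)" A] A \<delta> B by auto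
  have "\<exists>i. \<forall>j\<le>n. \<exists>k\<in>{j..M j}. i \<in> A k" for n
  proof -
    obtain i where "i \<in> (\<Inter>j\<in>{..n}. \<Union>k\<in>{j..M j}. A k)" using M[of n] by blast
    then show ?thesis by (intro exI[of _ i]) simp
  qed
  then obtain i where i: "\<And>n j. j \<le> n \<Longrightarrow> \<exists>k\<in>{j..M j}. i n \<in> A k" by metis
  define G where "G z = glim (\<lambda>n. f (i n) z)" for z
  have G: "((\<lambda>n. f (i n) z) \<longlongrightarrow> G z) F" for z
    unfolding G_def by (rule glim_tendsto[OF bd])
  have "bounded_linear G"
  proof
    show "G (x + y) = G x + G y" for x y
      unfolding G_def[of "x + y"]
      by (rule glim_eqI) (simp add: linear_add[OF lin] tendsto_add[OF G G])
    show "G (r *\<^sub>R x) = r *\<^sub>R G x" for r x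
      unfolding G_def[of "r *\<^sub>R x"]
      by (rule glim_eqI) (simp add: linear_scale[OF lin] tendsto_mult_left[OF G])
    have "\<bar>G x\<bar> \<le> C * norm x" for x
      by (rule tendsto_upperbound[OF tendsto_rabs[OF G] _ F_nontrivial]) (simp add: bd)
    then show "\<exists>K. \<forall>x. norm (G x) \<le> norm x * K"
      by (intro exI[of _ C]) (simp add: mult.commute)
  qed
  then have "(\<lambda>k. G (v k)) \<longlonglongrightarrow> 0"
    using v[unfolded weakly_null_def, rule_format, of "Blinfun G"]
    by (simp add: bounded_linear_Blinfun_apply)
  then obtain K where K: "\<And>k. k \<ge> K \<Longrightarrow> \<bar>G (v k)\<bar> < \<delta> / 2"
    using LIMSEQ_D[of "\<lambda>k. G (v k)" 0 "\<delta> / 2"] \<delta> by auto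
  have "\<forall>\<^sub>F n in F. \<forall>k\<in>{K..M K}. \<bar>f (i n) (v k)\<bar> < \<delta> / 2"
    by (intro eventually_ball_finite ballI order_tendstoD(2)[OF tendsto_rabs[OF G]] K) auto
  moreover have "\<forall>\<^sub>F n in F. K \<le> n"
    by (rule filter_leD[OF F_sequentially eventually_ge_at_top])
  ultimately have "\<forall>\<^sub>F n in F. K \<le> n \<and> (\<forall>k\<in>{K..M K}. \<bar>f (i n) (v k)\<bar> < \<delta> / 2)"
    by eventually_elim blast
  from eventually_happens'[OF F_nontrivial this] obtain n where
    "K \<le> n" "\<forall>k\<in>{K..M K}. \<bar>f (i n) (v k)\<bar> < \<delta> / 2" by blast
  then show False using i[of K n] by (force simp: A_def)
qed

end

section \<open>Rademacher functions\<close>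

definition rademacher :: "nat \<Rightarrow> nat \<Rightarrow> real" where
  "rademacher n i = (if bit i n then 1 else - 1)"

lemma abs_rademacher [simp]: "\<bar>rademacher n i\<bar> = 1"
  by (simp add: rademacher_def)

lemma avg_sum: "avg N (\<lambda>i. \<Sum>n\<in>S. g n i) = (\<Sum>n\<in>S. avg N (g n))"
  unfolding avg_def by (subst sum.swap) (simp add: sum_divide_distrib)

lemma sum_lessThan_power_Suc:
  fixes h :: "nat \<Rightarrow> real"
  shows "(\<Sum>i<2 ^ Suc N. h i) = (\<Sum>i<2 ^ N. h i + h (i + 2 ^ N))"
proof -
  have "(\<Sum>i<2 ^ Suc N. h i) = (\<Sum>i=0..<2 ^ N. h i) + (\<Sum>i=0 + 2 ^ N..<2 ^ N + 2 ^ N. h i)"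
    by (simp add: lessThan_atLeast0 sum.atLeastLessThan_concat mult_2)
  also have "(\<Sum>i=0 + 2 ^ N..<2 ^ N + 2 ^ N. h i) = (\<Sum>i=0..<2 ^ N. h (i + 2 ^ N))"
    by (rule sum.shift_bounds_nat_ivl)
  finally show ?thesis by (simp add: lessThan_atLeast0 sum.distrib)
qed

lemma rademacher_add_power:
  assumes "n \<le> N" "i < 2 ^ N"
  shows "rademacher n (i + 2 ^ N) = (if n = N then 1 else rademacher n i)"
    and "rademacher N i = - 1"
proof -
  show "rademacher N i = - 1" using assms(2) by (simp add: rademacher_def bit_iff_odd)
  have "(2 :: nat) ^ N = 2 ^ (N - n) * 2 ^ n" using assms(1) by (simp flip: power_add)
  then have "(i + 2 ^ N) div 2 ^ n = i div 2 ^ n + 2 ^ (N - n)" by simp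
  then show "rademacher n (i + 2 ^ N) = (if n = N then 1 else rademacher n i)"
    using assms by (simp add: rademacher_def bit_iff_odd)
qed

text \<open>
  Orthogonality, by induction on the length of the block: when the block is doubled, the new digit
  takes both signs while the old digits are repeated.
\<close>

lemma avg_rademacher_rademacher:
  assumes "n < N" "m < N"
  shows "avg N (\<lambda>i. rademacher n i * rademacher m i) = (if n = m then 1 else 0)"
proof (cases "n = m")
  case True
  have "rademacher m i * rademacher m i = 1" for i by (simp add: rademacher_def)
  then show ?thesis using True by (simp add: avg_simps)
next
  case False
  have *: "(\<Sum>i<2 ^ N. rademacher n i * rademacher m i) = 0" if "n < m" "m < N" for n m
    using that
  proof (induction N)
    case (Suc N)
    show ?case
    proof (cases "m = N")
      case True
      have "rademacher n i * rademacher m i + rademacher n (i + 2 ^ N) * rademacher m (i + 2 ^ N) = 0"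
        if "i < 2 ^ N" for i
        using rademacher_add_power[OF _ that, of n] rademacher_add_power[OF _ that, of N] True Suc.prems
        by simp
      then show ?thesis unfolding sum_lessThan_power_Suc by (intro sum.neutral) auto
    next
      case False
      have "rademacher n i * rademacher m i + rademacher n (i + 2 ^ N) * rademacher m (i + 2 ^ N) =
          2 * (rademacher n i * rademacher m i)" if "i < 2 ^ N" for i
        using rademacher_add_power(1)[OF _ that, of n] rademacher_add_power(1)[OF _ that, of m]
          False Suc.prems by simp
      then have "(\<Sum>i<2 ^ Suc N. rademacher n i * rademacher m i) =
          (\<Sum>i<2 ^ N. 2 * (rademacher n i * rademacher m i))"
        unfolding sum_lessThan_power_Suc by (intro sum.cong) auto
      also have "\<dots> = 2 * (\<Sum>i<2 ^ N. rademacher n i * rademacher m i)"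
        by (rule sum_distrib_left[symmetric])
      also have "\<dots> = 0" using Suc False by simp
      finally show ?thesis .
    qed
  qed simp
  have "(\<Sum>i<2 ^ N. rademacher n i * rademacher m i) = 0"
    using *[of n m] *[of m n] False assms by (cases n m rule: linorder_cases) (auto simp: mult.commute)
  then show ?thesis using False by (simp add: avg_def)
qed

text \<open>Bessel's inequality: the mean square distance of \<open>h\<close> to its projection \<open>S\<close> is nonnegative.\<close>

lemma bessel_rademacher:
  assumes h: "\<And>i. \<bar>h i\<bar> \<le> B" and k: "k \<le> N"
  shows "(\<Sum>n<k. (avg N (\<lambda>i. rademacher n i * h i))\<^sup>2) \<le> B\<^sup>2"
proof -
  define c where "c n = avg N (\<lambda>i. rademacher n i * h i)" for n
  define S where "S i = (\<Sum>n<k. c n * rademacher n i)" for i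
  have "avg N (\<lambda>i. S i * h i) = (\<Sum>n<k. c n * c n)"
    unfolding S_def sum_distrib_right mult.assoc avg_sum avg_simps(2) c_def ..
  moreover have "avg N (\<lambda>i. S i * S i) = (\<Sum>n<k. c n * c n)"
  proof -
    have "S i * S i = (\<Sum>n<k. \<Sum>m<k. c n * c m * (rademacher n i * rademacher m i))" for i
      unfolding S_def sum_product by (intro sum.cong refl) (simp add: mult_ac)
    then have "avg N (\<lambda>i. S i * S i) =
        (\<Sum>n<k. \<Sum>m<k. c n * c m * avg N (\<lambda>i. rademacher n i * rademacher m i))"
      by (simp add: avg_sum avg_simps)
    also have "\<dots> = (\<Sum>n<k. \<Sum>m<k. if n = m then c n * c m else 0)"
      using k by (intro sum.cong refl) (simp add: avg_rademacher_rademacher)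
    also have "\<dots> = (\<Sum>n<k. c n * c n)" by (simp add: sum.delta)
    finally show ?thesis .
  qed
  moreover have "avg N (\<lambda>i. (h i - S i)\<^sup>2) =
      avg N (\<lambda>i. (h i)\<^sup>2) + (- 2) * avg N (\<lambda>i. S i * h i) + avg N (\<lambda>i. S i * S i)"
    unfolding avg_simps(1,2)[symmetric]
    by (intro arg_cong[where f = "avg N"] ext) (simp add: power2_eq_square algebra_simps)
  moreover have "0 \<le> avg N (\<lambda>i. (h i - S i)\<^sup>2)"
    by (simp add: avg_def sum_nonneg)
  moreover have "avg N (\<lambda>i. (h i)\<^sup>2) \<le> avg N (\<lambda>_. B\<^sup>2)"
    by (intro avg_mono) (metis h abs_ge_zero power2_abs power_mono)
  ultimately show ?thesis by (simp add: avg_simps c_def power2_eq_square)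
qed

section \<open>Weakly precompact norming sets exclude copies of \<open>\<ell>\<^sub>1\<close>\<close>

text \<open>
  Each sequence of signs is a functional of norm one on \<open>\<ell>\<^sub>1\<close>. It extends from the copy of \<open>\<ell>\<^sub>1\<close>,
  with a bound that does not depend on the signs.
\<close>

lemma ell1_sign_functional:
  fixes T :: "ell1 \<Rightarrow> 'a::real_normed_vector"
  assumes T: "linear T" and C: "C \<ge> 0" and low: "\<And>a. norm a \<le> C * norm (T a)"
    and \<epsilon>: "\<And>n. \<bar>\<epsilon> n\<bar> \<le> 1"
  shows "\<exists>f :: 'a \<Rightarrow> real. linear f \<and> (\<forall>z. \<bar>f z\<bar> \<le> C * norm z) \<and>
    (\<forall>a. f (T a) = (\<Sum>n. ell1_nth a n * \<epsilon> n))"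
proof -
  have bl: "bounded_linear (\<lambda>a. \<Sum>n. ell1_nth a n *\<^sub>R \<epsilon> n)"
    by (rule ell1_operator(2)[of \<epsilon> 1]) (simp add: \<epsilon>)
  have "(\<Sum>n. ell1_nth a n * \<epsilon> n) \<le> C * norm (T a)" for a
  proof -
    have le: "ell1_nth a n * \<epsilon> n \<le> \<bar>ell1_nth a n\<bar>" for n
    proof -
      have "\<bar>ell1_nth a n\<bar> * \<bar>\<epsilon> n\<bar> \<le> \<bar>ell1_nth a n\<bar> * 1" by (intro mult_left_mono \<epsilon>) auto
      then show ?thesis using abs_ge_self[of "ell1_nth a n * \<epsilon> n"] by (simp add: abs_mult)
    qed
    have "summable (\<lambda>n. ell1_nth a n * \<epsilon> n)"
      using sums_summable[OF ell1_operator(1)[of \<epsilon> 1 a]] \<epsilon> by simp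
    then have "(\<Sum>n. ell1_nth a n * \<epsilon> n) \<le> norm a"
      unfolding norm_ell1_eq by (intro suminf_le le summable_ell1)
    then show ?thesis using low[of a] by linarith
  qed
  then obtain f :: "'a \<Rightarrow> real" where "linear f" "\<And>z. \<bar>f z\<bar> \<le> C * norm z"
      "\<And>a. f (T a) = (\<Sum>n. ell1_nth a n * \<epsilon> n)"
    using dominated_functional_extension[OF T _ C, of "\<lambda>a. \<Sum>n. ell1_nth a n * \<epsilon> n"]
      bounded_linear.linear[OF bl] by (metis (no_types, lifting) real_scaleR_def ext)
  then show ?thesis by blast
qed

lift_definition ell1_unit :: "nat \<Rightarrow> ell1" is "\<lambda>n k. if k = n then 1 else 0"
  by (rule summable_finite[of "{n}" for n]) auto

text \<open>
  The map \<open>z \<mapsto> (\<lambda>i. f i z)\<close> extends the embedding of \<open>\<ell>\<^sub>1\<close> by the Rademacher functions into the bounded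
  functions. Its composition with the map into the functions with the mean of the absolute values
  as norm turns weak Cauchy sequences into norm Cauchy ones. The Rademacher coefficients \<open>\<phi> n\<close>
  would then tend to zero uniformly on the weakly precompact set \<open>W\<close>, hence in norm.
\<close>

lemma not_contains_ell1_if_norming_weakly_precompact:
  fixes W :: "'a::banach set"
  assumes W: "weakly_precompact W"
    and norming: "\<And>(\<phi> :: 'a \<Rightarrow> real) M z. bounded_linear \<phi> \<Longrightarrow> (\<And>w. w \<in> W \<Longrightarrow> \<bar>\<phi> w\<bar> \<le> M) \<Longrightarrow>
      M \<ge> 0 \<Longrightarrow> \<bar>\<phi> z\<bar> \<le> M * norm z"
  shows "\<not> contains_ell1 TYPE('a)"
proof
  assume "contains_ell1 TYPE('a)"
  then obtain T :: "ell1 \<Rightarrow> 'a" and C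
    where T: "bounded_linear T" and C: "C > 0" and low: "\<And>a. norm a \<le> C * norm (T a)"
    by (rule contains_ell1E) blast
  obtain F where "generalized_limit F" using generalized_limit_exists by blast
  then interpret generalized_limit F .
  have "\<exists>f :: nat \<Rightarrow> 'a \<Rightarrow> real. \<forall>i. linear (f i) \<and> (\<forall>z. \<bar>f i z\<bar> \<le> C * norm z) \<and>
      (\<forall>a. f i (T a) = (\<Sum>n. ell1_nth a n * rademacher n i))"
    by (intro choice allI ell1_sign_functional bounded_linear.linear[OF T] low) (use C in auto)
  then obtain f :: "nat \<Rightarrow> 'a \<Rightarrow> real" where lin: "\<And>i. linear (f i)"
    and bd: "\<And>i z. \<bar>f i z\<bar> \<le> C * norm z"
    and fT: "\<And>i a. f i (T a) = (\<Sum>n. ell1_nth a n * rademacher n i)" by blast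
  have funit: "f i (T (ell1_unit n)) = rademacher n i" for i n
  proof -
    have "(\<Sum>k. ell1_nth (ell1_unit n) k * rademacher k i) =
        (\<Sum>k\<in>{n}. ell1_nth (ell1_unit n) k * rademacher k i)"
      by (intro suminf_finite) (auto simp: ell1_unit.rep_eq)
    then show ?thesis by (simp add: fT ell1_unit.rep_eq)
  qed
  have norm_unit: "norm (ell1_unit n) = 1" for n
  proof -
    have "(\<Sum>k. \<bar>ell1_nth (ell1_unit n) k\<bar>) = (\<Sum>k\<in>{n}. \<bar>ell1_nth (ell1_unit n) k\<bar>)"
      by (intro suminf_finite) (auto simp: ell1_unit.rep_eq)
    then show ?thesis by (simp add: norm_ell1_eq ell1_unit.rep_eq)
  qed
  define \<phi> where "\<phi> n z = mean (\<lambda>i. rademacher n i * f i z)" for n z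
  have rbd: "\<bar>rademacher n i * f i z\<bar> \<le> C * norm z" for n i z
    by (simp add: abs_mult bd)
  have \<phi>lin: "bounded_linear (\<phi> n)" for n
  proof
    show "\<phi> n (x + y) = \<phi> n x + \<phi> n y" for x y
      unfolding \<phi>_def mean_add[OF rbd rbd, symmetric] by (simp add: linear_add[OF lin] distrib_left)
    show "\<phi> n (r *\<^sub>R x) = r *\<^sub>R \<phi> n x" for r x
      unfolding \<phi>_def real_scaleR_def mean_mult[OF rbd, symmetric]
      by (simp add: linear_scale[OF lin] mult_ac)
    have "\<bar>\<phi> n x\<bar> \<le> C * norm x" for x
      unfolding \<phi>_def by (rule abs_mean_le[OF rbd])
    then show "\<exists>K. \<forall>x. norm (\<phi> n x) \<le> norm x * K"
      by (intro exI[of _ C]) (simp add: mult.commute)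
  qed
  have \<phi>unit: "\<phi> n (T (ell1_unit n)) = 1" for n
  proof -
    have "rademacher n i * rademacher n i = 1" for i by (simp add: rademacher_def)
    then show ?thesis by (simp add: \<phi>_def funit mean_const)
  qed
  have \<phi>0: "(\<lambda>n. \<phi> n z) \<longlonglongrightarrow> 0" for z
  proof -
    have le: "(\<Sum>n<k. (\<phi> n z)\<^sup>2) \<le> (C * norm z)\<^sup>2" for k
    proof (rule tendsto_upperbound[OF _ _ F_nontrivial])
      show "((\<lambda>N. \<Sum>n<k. (avg N (\<lambda>i. rademacher n i * f i z))\<^sup>2) \<longlongrightarrow> (\<Sum>n<k. (\<phi> n z)\<^sup>2)) F"
        unfolding \<phi>_def by (intro tendsto_intros mean_tendsto[OF rbd])
      show "\<forall>\<^sub>F N in F. (\<Sum>n<k. (avg N (\<lambda>i. rademacher n i * f i z))\<^sup>2) \<le> (C * norm z)\<^sup>2"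
        using filter_leD[OF F_sequentially eventually_ge_at_top[of k]]
        by (rule eventually_mono) (rule bessel_rademacher[OF bd])
    qed
    have "summable (\<lambda>n. (\<phi> n z)\<^sup>2)"
      by (rule summableI_nonneg_bounded[OF _ le]) simp
    then have "(\<lambda>n. (\<phi> n z)\<^sup>2) \<longlonglongrightarrow> 0" by (rule summable_LIMSEQ_zero)
    from tendsto_real_sqrt[OF this] show ?thesis by (simp add: tendsto_rabs_zero_iff)
  qed
  have \<phi>mean: "\<bar>\<phi> n z\<bar> \<le> mean (\<lambda>i. \<bar>f i z\<bar>)" for n z
  proof (rule tendsto_le[OF F_nontrivial])
    show "((\<lambda>N. avg N (\<lambda>i. \<bar>f i z\<bar>)) \<longlongrightarrow> mean (\<lambda>i. \<bar>f i z\<bar>)) F"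
      by (rule mean_tendsto[of _ "C * norm z"]) (simp add: bd)
    show "((\<lambda>N. \<bar>avg N (\<lambda>i. rademacher n i * f i z)\<bar>) \<longlongrightarrow> \<bar>\<phi> n z\<bar>) F"
      unfolding \<phi>_def by (intro tendsto_rabs mean_tendsto[OF rbd])
    have "\<bar>avg N (\<lambda>i. rademacher n i * f i z)\<bar> \<le> avg N (\<lambda>i. \<bar>f i z\<bar>)" for N
      unfolding avg_def abs_divide
      by (intro divide_mono order_trans[OF sum_abs]) (auto simp: abs_mult sum_nonneg)
    then show "\<forall>\<^sub>F N in F. \<bar>avg N (\<lambda>i. rademacher n i * f i z)\<bar> \<le> avg N (\<lambda>i. \<bar>f i z\<bar>)" by simp
  qed
  obtain B where B: "B > 0" "\<And>a. norm (T a) \<le> norm a * B"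
    using bounded_linear.pos_bounded[OF T] by blast
  \<comment> \<open>If \<open>\<phi> n\<close> had norm at most \<open>M\<close>, then its value 1 at the \<open>n\<close>-th unit vector would be at most 1/2.\<close>
  define M where "M = 1 / (2 * B)"
  have M: "M > 0" using B by (simp add: M_def)
  have "\<exists>w\<in>W. M < \<bar>\<phi> n w\<bar>" for n
  proof (rule ccontr)
    assume "\<not> ?thesis"
    then have "\<bar>\<phi> n (T (ell1_unit n))\<bar> \<le> M * norm (T (ell1_unit n))"
      using M by (intro norming \<phi>lin) (auto simp: not_less)
    also have "\<dots> \<le> M * B" using M B(2)[of "ell1_unit n"] by (simp add: norm_unit)
    finally show False using B(1) by (simp add: \<phi>unit M_def)
  qed
  then obtain w where w: "\<And>n. w n \<in> W" "\<And>n. M < \<bar>\<phi> n (w n)\<bar>" by metis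
  then obtain r where r: "strict_mono r" "weakly_Cauchy (w \<circ> r)"
    using W unfolding weakly_precompact_def by (metis image_subsetI)
  \<comment> \<open>The functional belonging to a late vector is small on the \<open>k\<close>-th one but large on its own vector,
    hence large on their difference.\<close>
  have "\<exists>j\<ge>k. \<bar>\<phi> (r j) (w (r k))\<bar> < M / 2" for k
  proof -
    have "(\<lambda>j. \<phi> (r j) (w (r k))) \<longlonglongrightarrow> 0"
      using LIMSEQ_subseq_LIMSEQ[OF \<phi>0 r(1)] by (simp add: o_def)
    then obtain N where "\<And>j. j \<ge> N \<Longrightarrow> \<bar>\<phi> (r j) (w (r k))\<bar> < M / 2"
      using LIMSEQ_D[of "\<lambda>j. \<phi> (r j) (w (r k))" 0 "M / 2"] M by auto
    then show ?thesis by (intro exI[of _ "max N k"]) auto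
  qed
  then obtain q where q: "\<And>k. k \<le> q k" "\<And>k. \<bar>\<phi> (r (q k)) (w (r k))\<bar> < M / 2" by metis
  define v where "v k = w (r (q k)) - w (r k)" for k
  have "weakly_null v"
    using weakly_Cauchy_subseq_diff[OF r(2), of q "\<lambda>k. k"] q(1) by (simp add: v_def[abs_def])
  then obtain k where k: "mean (\<lambda>i. \<bar>f i (v k)\<bar>) < M / 2"
    using mean_small_on_weakly_null[OF lin bd] M by (meson half_gt_zero)
  have "\<phi> (r (q k)) (v k) = \<phi> (r (q k)) (w (r (q k))) - \<phi> (r (q k)) (w (r k))"
    unfolding v_def by (rule linear_diff[OF bounded_linear.linear[OF \<phi>lin]])
  then have "M / 2 < \<bar>\<phi> (r (q k)) (v k)\<bar>"
    using w(2)[of "r (q k)"] q(2)[of k] by linarith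
  then show False using \<phi>mean[of "r (q k)" "v k"] k by linarith
qed

theorem theorem4p4:
  assumes "dunford_pettis TYPE('a::banach) \<or> dunford_pettis TYPE('b::banach) \<or>
    (UNIV :: ('a \<Rightarrow>\<^sub>L ('b \<Rightarrow>\<^sub>L real)) set) = compact_operators"
  shows "(\<forall>(x :: nat \<Rightarrow> 'a) (y :: nat \<Rightarrow> 'b).
            weakly_Cauchy x \<longrightarrow> weakly_Cauchy y \<longrightarrow> weakly_Cauchy (\<lambda>n. x n \<otimes>\<^sub>\<pi> y n)) \<and>
         (\<forall>(W1 :: 'a set) (W2 :: 'b set).
            weakly_precompact W1 \<longrightarrow> weakly_precompact W2 \<longrightarrow>
            weakly_precompact (set_ptensor W1 W2)) \<and>
         (\<not> contains_ell1 TYPE('a) \<longrightarrow> \<not> contains_ell1 TYPE('b) \<longrightarrow>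
            \<not> contains_ell1 TYPE(('a, 'b) projective_tensor))"
proof (intro conjI allI impI)
  show a: "weakly_Cauchy (\<lambda>n. x n \<otimes>\<^sub>\<pi> y n)" if "weakly_Cauchy x" "weakly_Cauchy y"
    for x :: "nat \<Rightarrow> 'a" and y :: "nat \<Rightarrow> 'b"
    by (rule weakly_Cauchy_ptensor[OF assms that])
  show b: "weakly_precompact (set_ptensor W1 W2)" if "weakly_precompact W1" "weakly_precompact W2"
    for W1 :: "'a set" and W2 :: "'b set"
    by (rule weakly_precompact_set_ptensor[OF a that])
  assume X: "\<not> contains_ell1 TYPE('a)" and Y: "\<not> contains_ell1 TYPE('b)"
  let ?W = "set_ptensor (cball 0 1 :: 'a set) (cball 0 1 :: 'b set)"
  show "\<not> contains_ell1 TYPE(('a, 'b) projective_tensor)"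
  proof (rule not_contains_ell1_if_norming_weakly_precompact)
    show "weakly_precompact ?W" by (intro b weakly_precompact_unit_ball_if_no_ell1 X Y)
    fix \<phi> :: "('a, 'b) projective_tensor \<Rightarrow> real" and M z
    assume \<phi>: "bounded_linear \<phi>" and M: "\<And>w. w \<in> ?W \<Longrightarrow> \<bar>\<phi> w\<bar> \<le> M" "M \<ge> 0"
    show "\<bar>\<phi> z\<bar> \<le> M * norm z"
    proof (rule functional_le_if_le_on_elementary_tensors[OF \<phi>])
      fix x :: 'a and y :: 'b
      interpret A: bounded_bilinear "\<lambda>x y. \<phi> (x \<otimes>\<^sub>\<pi> y)"
        by (rule bounded_bilinear_functional_ptensor[OF \<phi>])
      have "sgn x \<otimes>\<^sub>\<pi> sgn y \<in> ?W"
        unfolding set_ptensor_def mem_Collect_eq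
        by (intro exI[of _ "sgn x"] exI[of _ "sgn y"]) (simp add: norm_sgn)
      then have "\<bar>\<phi> (sgn x \<otimes>\<^sub>\<pi> sgn y)\<bar> * (norm x * norm y) \<le> M * (norm x * norm y)"
        by (intro mult_right_mono M) auto
      moreover have "\<phi> (x \<otimes>\<^sub>\<pi> y) = \<phi> (sgn x \<otimes>\<^sub>\<pi> sgn y) * (norm x * norm y)"
      proof -
        have "x = norm x *\<^sub>R sgn x" "y = norm y *\<^sub>R sgn y"
          by (cases "x = 0"; cases "y = 0"; simp add: sgn_div_norm)+
        then have "\<phi> (x \<otimes>\<^sub>\<pi> y) = \<phi> ((norm x *\<^sub>R sgn x) \<otimes>\<^sub>\<pi> (norm y *\<^sub>R sgn y))" by simp
        then show ?thesis by (simp only: A.scaleR_left A.scaleR_right real_scaleR_def mult_ac)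
      qed
      ultimately show "\<bar>\<phi> (x \<otimes>\<^sub>\<pi> y)\<bar> \<le> M * (norm x * norm y)" by (simp add: abs_mult)
    qed
  qed
qed

end
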